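(* Let $\mathbb{F}$ be a finitely generated free group, $V$ a finite set, $\mathcal{L}:V\to\mathbb{F}$ a map, $\Pi=(\Pi_{v,w})_{v,w\in V}$ a stochastic matrix with a stationary distribution $\nu$ satisfying $\nu(v)>0$ for all $v\in V$, and let $\mathbb{F}\curvearrowright(X,\mu)$ be a measure-preserving action on a probability space. If the directed graph $G$ associated with $\Pi$ contains a good subgraph of order $k$ (with $k\ge1$), then $\mathcal{F}^X_{2k}=\mathcal{F}^X_{sync}$ up to sets of measure zero.
   Context: Stochastic means $\Pi_{v,w}\ge 0$ and $\sum_{w}\Pi_{v,w}=1$ for every $v$. A stationary distribution is a probability distribution $\nu$ on $V$ with $\sum_{v}\nu(v)\Pi_{v,w}=\nu(w)$ for every $w$. The directed graph associated with $\Pi$ is $G=(V,E)$, $E=\{(w,v):\Pi_{v,w}>0\}$. A directed path of length $n$ is $(s_1,\dots,s_n)\in V^n$ with $(s_i,s_{i+1})\in E$ for $1\le i<n$; $\mathcal{L}(s_1,\dots,s_n)=\mathcal{L}(s_1)\cdots\mathcal{L}(s_n)$; juxtaposition denotes concatenation. $G$ contains a good subgraph of order $k$ if there are vertices $u,w\in V$ and directed paths $p,q,p^*,q^*$ of length $k$ such that $upw$, $uqw$, $pq^*p$, $qp^*q$ are directed paths in $G$, and $\mathcal{L}(p^* )=\mathcal{L}(p)^{-1}$, $\mathcal{L}(q^* )=\mathcal{L}(q)^{-1}$. With $\mathbb{N}=\{1,2,\dots\}$, $\tilde\nu$ is the Borel probability measure on $V^{\mathbb{N}}$ with $$\tilde\nu(\{s: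 s_i=t_i,\ 1\le i\le n\})=\nu(t_n)\Pi_{t_n,t_{n-1}}\cdots\Pi_{t_2,t_1}$$ for all $t_1,\dots,t_n\in V$; $V^{\mathbb{N}}\times X$ carries the measure $\tilde\nu\times\mu$. Equivalence relations. $\mathcal{R}_{sync}$ is the set of pairs $(s,t)\in V^{\mathbb{N}}\times V^{\mathbb{N}}$ such that $s_i=t_i$ for all sufficiently large $i$. For $m\ge1$, $\mathcal{R}_m$ is the set of pairs $(s,t)$ for which there are $r\in\mathbb{Z}$ and $N\in\mathbb{N}$ (with $N+rm\ge1$) such that $s_{rm+i}=t_i$ for all $i\ge N$. The cocycle $\alpha:\mathcal{R}_1\to\mathbb{F}$ is $$\alpha(s,t)=\mathcal{L}(s_1)\cdots\mathcal{L}(s_{N+p})\,(\mathcal{L}(t_1)\cdots\mathcal{L}(t_N))^{-1}$$ whenever $s_{p+i}=t_i$ for all $i\ge N$. The value can depend on the choice of $p$ only for eventually periodic sequences. For a subrelation $\mathcal{S}\subset\mathcal{R}_1$, the skew product relation on $V^{\mathbb{N}}\times X$ is $\mathcal{S}^X=\{((s,x),(t,y)): (s,t)\in\mathcal{S},\ \alpha(t,s)x=y\}$. Where $\alpha$ might depend on the choice of $p$, this is read as follows: $\alpha$ is computed with $p=0$ for $\mathcal{R}_{sync}$, and with some admissible $p=rm$ as in the definition of $\mathcal{R}_m$ for $\mathcal{R}_m$. $\mathcal{F}^X_{sync}$ and $\mathcal{F}^X_{m}$ are the sigma-algebras of measurable subsets of $V^{\mathbb{N}}\times X$ that are unions of $\mathcal{R}_{sync}^X$-classes,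 respectively $\mathcal{R}_m^X$-classes. "Equal up to sets of measure zero" means every set in either sigma-algebra differs from some set in the other by a $\tilde\nu\times\mu$-null set.
   Formalization: The matrix Π is additionally assumed irreducible (the graph G is strongly connected); without this the claim fails, e.g. for a loop with trivial label next to a disjoint directed 3-cycle with k = 1. *)

theory Defs
  imports "HOL-Probability.Probability" "HOL-Algebra.Group_Action" "HOL-Algebra.Generated_Groups"
begin

definition gprod :: "('g, 'b) monoid_scheme \<Rightarrow> 'g list \<Rightarrow> 'g" where
  "gprod F gs = foldr (\<lambda>g h. g \<otimes>\<^bsub>F\<^esub> h) gs \<one>\<^bsub>F\<^esub>"

text \<open>A letter is a pair \<open>(b, x)\<close>: it stands for \<open>x\<close> if \<open>b\<close> holds and for the inverse of \<open>x\<close> otherwise.\<close>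

definition letter_val :: "('g, 'b) monoid_scheme \<Rightarrow> bool \<times> 'g \<Rightarrow> 'g" where
  "letter_val F l = (if fst l then snd l else inv\<^bsub>F\<^esub> (snd l))"

definition reduced_words :: "'g set \<Rightarrow> (bool \<times> 'g) list set" where
  "reduced_words S =
     {w \<in> lists (UNIV \<times> S). successively (\<lambda>l l'. \<not> (snd l = snd l' \<and> fst l \<noteq> fst l')) w}"

definition free_basis :: "('g, 'b) monoid_scheme \<Rightarrow> 'g set \<Rightarrow> bool" where
  "free_basis F S \<longleftrightarrow> S \<subseteq> carrier F \<and>
     (\<forall>g \<in> carrier F. \<exists>!w. w \<in> reduced_words S \<and> gprod F (map (letter_val F) w) = g)"

definition free_group :: "('g, 'b) monoid_scheme \<Rightarrow> bool" where
  "free_group F \<longleftrightarrow> group F \<and> (\<exists>S. free_basis F S)"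

definition finitely_generated_group :: "('g, 'b) monoid_scheme \<Rightarrow> bool" where
  "finitely_generated_group F \<longleftrightarrow>
     group F \<and> (\<exists>A. finite A \<and> A \<subseteq> carrier F \<and> generate F A = carrier F)"

definition stochastic_matrix :: "('v::finite \<Rightarrow> 'v \<Rightarrow> real) \<Rightarrow> bool" where
  "stochastic_matrix P \<longleftrightarrow> (\<forall>v w. P v w \<ge> 0) \<and> (\<forall>v. (\<Sum>w\<in>UNIV. P v w) = 1)"

definition stationary_distribution :: "('v::finite \<Rightarrow> 'v \<Rightarrow> real) \<Rightarrow> ('v \<Rightarrow> real) \<Rightarrow> bool" where
  "stationary_distribution P \<nu> \<longleftrightarrow>
     (\<forall>v. \<nu> v \<ge> 0) \<and> (\<Sum>v\<in>UNIV. \<nu> v) = 1 \<and> (\<forall>w. (\<Sum>v\<in>UNIV. \<nu> v * P v w) = \<nu> w)"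

text \<open>Edges run against the transitions of the matrix.\<close>

definition edges :: "('v \<Rightarrow> 'v \<Rightarrow> real) \<Rightarrow> ('v \<times> 'v) set" where
  "edges P = {(w, v). P v w > 0}"

definition directed_path :: "('v \<Rightarrow> 'v \<Rightarrow> real) \<Rightarrow> 'v list \<Rightarrow> bool" where
  "directed_path P = successively (\<lambda>v w. (v, w) \<in> edges P)"

text \<open>
  Irreducibility of the matrix: its graph is strongly connected.  A positive stationary
  distribution alone still allows the graph to be a disjoint union of strongly connected
  components.  A good subgraph in one of them says nothing about the others (consider a loop with
  trivial label next to a directed 3-cycle, and shifts by 2), so irreducibility is a separate
  assumption.
\<close>

definition irreducible_matrix :: "('v \<Rightarrow> 'v \<Rightarrow> real) \<Rightarrow> bool" where
  "irreducible_matrix P \<longleftrightarrow> (\<forall>v w. (v, w) \<in> (edges P)\<^sup>*)"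

definition path_label :: "('g, 'b) monoid_scheme \<Rightarrow> ('v \<Rightarrow> 'g) \<Rightarrow> 'v list \<Rightarrow> 'g" where
  "path_label F L p = gprod F (map L p)"

definition has_good_subgraph ::
  "('g, 'b) monoid_scheme \<Rightarrow> ('v \<Rightarrow> 'g) \<Rightarrow> ('v \<Rightarrow> 'v \<Rightarrow> real) \<Rightarrow> nat \<Rightarrow> bool" where
  "has_good_subgraph F L P k \<longleftrightarrow>
     (\<exists>u w p q p' q'.
        length p = k \<and> length q = k \<and> length p' = k \<and> length q' = k \<and>
        directed_path P p \<and> directed_path P q \<and> directed_path P p' \<and> directed_path P q' \<and>
        directed_path P ([u] @ p @ [w]) \<and> directed_path P ([u] @ q @ [w]) \<and>
        directed_path P (p @ q' @ p) \<and> directed_path P (q @ p' @ q) \<and>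
        path_label F L p' = inv\<^bsub>F\<^esub> (path_label F L p) \<and>
        path_label F L q' = inv\<^bsub>F\<^esub> (path_label F L q))"

text \<open>
  Sequences are indexed by \<open>{1..}\<close>; being elements of the space of a product measure they take
  the value \<open>undefined\<close> at \<open>0\<close>.  Since the vertex set is finite and discrete and the index set is
  countable, the product sigma-algebra is the Borel sigma-algebra.
\<close>

definition seq_algebra :: "(nat \<Rightarrow> 'v) measure" where
  "seq_algebra = PiM {1..} (\<lambda>_. count_space UNIV)"

abbreviation seqs :: "(nat \<Rightarrow> 'v) set" where
  "seqs \<equiv> space seq_algebra"

text \<open>
  The values on cylinders determine the measure uniquely, and stationarity makes them consistent,
  so that it exists.
\<close>

definition is_path_measure ::
  "('v \<Rightarrow> 'v \<Rightarrow> real) \<Rightarrow> ('v \<Rightarrow> real) \<Rightarrow> (nat \<Rightarrow> 'v) measure \<Rightarrow> bool" where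
  "is_path_measure P \<nu> N \<longleftrightarrow>
     prob_space N \<and> sets N = sets seq_algebra \<and>
     (\<forall>n\<ge>1. \<forall>t. measure N {s \<in> seqs. \<forall>i\<in>{1..n}. s i = t i} =
                  \<nu> (t n) * (\<Prod>i\<in>{1..<n}. P (t (Suc i)) (t i)))"

definition measure_preserving_action ::
  "('g, 'b) monoid_scheme \<Rightarrow> 'x measure \<Rightarrow> ('g \<Rightarrow> 'x \<Rightarrow> 'x) \<Rightarrow> bool" where
  "measure_preserving_action F M \<phi> \<longleftrightarrow>
     group_action F (space M) \<phi> \<and>
     (\<forall>g \<in> carrier F. \<phi> g \<in> measurable M M \<and> distr M M (\<phi> g) = M)"

definition shift_agree :: "int \<Rightarrow> nat \<Rightarrow> (nat \<Rightarrow> 'v) \<Rightarrow> (nat \<Rightarrow> 'v) \<Rightarrow> bool" where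
  "shift_agree p N s t \<longleftrightarrow> N \<ge> 1 \<and> int N + p \<ge> 1 \<and> (\<forall>i\<ge>N. s (nat (p + int i)) = t i)"

definition R_sync :: "((nat \<Rightarrow> 'v) \<times> (nat \<Rightarrow> 'v)) set" where
  "R_sync = {(s, t). s \<in> seqs \<and> t \<in> seqs \<and> (\<exists>N. \<forall>i\<ge>N. s i = t i)}"

definition R_tail :: "nat \<Rightarrow> ((nat \<Rightarrow> 'v) \<times> (nat \<Rightarrow> 'v)) set" where
  "R_tail m = {(s, t). s \<in> seqs \<and> t \<in> seqs \<and> (\<exists>r N. shift_agree (r * int m) N s t)}"

text \<open>
  \<open>cocycle_val F L p s t g\<close>: the cocycle, computed with the shift \<open>p\<close>, takes the value \<open>g\<close>
  at \<open>(s, t)\<close>.  For fixed \<open>p\<close> the value does not depend on \<open>N\<close>.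
\<close>

definition cocycle_val ::
  "('g, 'b) monoid_scheme \<Rightarrow> ('v \<Rightarrow> 'g) \<Rightarrow> int \<Rightarrow> (nat \<Rightarrow> 'v) \<Rightarrow> (nat \<Rightarrow> 'v) \<Rightarrow> 'g \<Rightarrow> bool" where
  "cocycle_val F L p s t g \<longleftrightarrow>
     (\<exists>N. shift_agree p N s t \<and>
          g = path_label F L (map s [1..<Suc (nat (int N + p))]) \<otimes>\<^bsub>F\<^esub>
              inv\<^bsub>F\<^esub> (path_label F L (map t [1..<Suc N])))"

text \<open>
  The skew product of a relation \<open>S\<close>, where the cocycle may be computed with any admissible
  shift from the set \<open>D\<close>.  The choice matters only for eventually periodic sequences.
\<close>

definition skew_relation ::
  "('g, 'b) monoid_scheme \<Rightarrow> ('v \<Rightarrow> 'g) \<Rightarrow> 'x measure \<Rightarrow> ('g \<Rightarrow> 'x \<Rightarrow> 'x) \<Rightarrow>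
   ((nat \<Rightarrow> 'v) \<times> (nat \<Rightarrow> 'v)) set \<Rightarrow> int set \<Rightarrow>
   (((nat \<Rightarrow> 'v) \<times> 'x) \<times> ((nat \<Rightarrow> 'v) \<times> 'x)) set" where
  "skew_relation F L M \<phi> S D =
     {((s, x), (t, y)). (s, t) \<in> S \<and> x \<in> space M \<and> y \<in> space M \<and>
        (\<exists>p\<in>D. \<exists>g. cocycle_val F L p t s g \<and> \<phi> g x = y)}"

definition R_sync_skew where
  "R_sync_skew F L M \<phi> = skew_relation F L M \<phi> R_sync {0}"

definition R_tail_skew where
  "R_tail_skew F L M \<phi> m = skew_relation F L M \<phi> (R_tail m) {r * int m |r. True}"

definition saturated_sets :: "'a measure \<Rightarrow> ('a \<times> 'a) set \<Rightarrow> 'a set set" where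
  "saturated_sets Q R = {A \<in> sets Q. \<exists>C. C \<subseteq> space Q // R \<and> A = \<Union>C}"

definition equal_mod_null :: "'a measure \<Rightarrow> 'a set set \<Rightarrow> 'a set set \<Rightarrow> bool" where
  "equal_mod_null Q \<A> \<B> \<longleftrightarrow>
     (\<forall>A\<in>\<A>. \<exists>B\<in>\<B>. sym_diff A B \<in> null_sets Q) \<and>
     (\<forall>B\<in>\<B>. \<exists>A\<in>\<A>. sym_diff A B \<in> null_sets Q)"

definition F_sync ::
  "('g, 'b) monoid_scheme \<Rightarrow> ('v \<Rightarrow> 'g) \<Rightarrow> (nat \<Rightarrow> 'v) measure \<Rightarrow> 'x measure \<Rightarrow> ('g \<Rightarrow> 'x \<Rightarrow> 'x) \<Rightarrow>
   ((nat \<Rightarrow> 'v) \<times> 'x) set set" where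
  "F_sync F L N M \<phi> = saturated_sets (N \<Otimes>\<^sub>M M) (R_sync_skew F L M \<phi>)"

definition F_tail ::
  "('g, 'b) monoid_scheme \<Rightarrow> ('v \<Rightarrow> 'g) \<Rightarrow> (nat \<Rightarrow> 'v) measure \<Rightarrow> 'x measure \<Rightarrow> ('g \<Rightarrow> 'x \<Rightarrow> 'x) \<Rightarrow> nat \<Rightarrow>
   ((nat \<Rightarrow> 'v) \<times> 'x) set set" where
  "F_tail F L N M \<phi> m = saturated_sets (N \<Otimes>\<^sub>M M) (R_tail_skew F L M \<phi> m)"

end

theory Submission
  imports Defs
begin

text \<open>
  Put \<open>T (s, x) = (shift s, \<phi> (L (s 1))\<inverse> x)\<close>.  A point \<open>(s, x)\<close> is synchronously equivalent to
  \<open>(t, y)\<close> iff \<open>T\<^sup>n (s, x) = T\<^sup>n (t, y)\<close> for some \<open>n\<close>, and equivalent for shifts by multiples of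
  \<open>m\<close> iff \<open>T\<^sup>a (s, x) = T\<^sup>b (t, y)\<close> for some \<open>a\<close> and \<open>b\<close> with \<open>m\<close> dividing \<open>b - a\<close>.  So one sigma-algebra
  contains the other, and what has to be shown is that a synchronously saturated set \<open>A\<close> is
  invariant under \<open>T\<^sup>2\<^sup>k\<close> up to a null set; the points whose \<open>T\<^sup>2\<^sup>k\<close>-orbit visits \<open>A\<close> infinitely often
  then form a saturated set that differs from \<open>A\<close> by a null set.

  Saturation means that \<open>A = T\<^sup>-\<^sup>n A\<^sub>n\<close> for sets \<open>A\<^sub>n\<close>, one for every \<open>n\<close>.  As \<open>A\<close> is nearly determined by
  \<open>x\<close> and finitely many coordinates of \<open>s\<close>, the set \<open>A\<^sub>n\<close> is for large \<open>n\<close> nearly of the form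
  \<open>V\<^sup>\<nat> \<times> C\<close> on every one-coordinate cylinder \<open>[v]\<close>, with \<open>C\<close> depending on \<open>n\<close> and \<open>v\<close>.  This
  follows from the Markov property and plays the part of a 0-1 law
  (\<open>slabs_from_finitary\<close>, \<open>descending_near_slab\<close>).

  Now let \<open>C\<close> describe \<open>A\<^sub>n\<close> on \<open>[u]\<close>.  Each of the paths \<open>u p w\<close>, \<open>u q w\<close> and \<open>u p q* p w\<close> occupies a
  definite proportion of \<open>[u]\<close>, and prepending its part before \<open>w\<close> to a sequence in \<open>[w]\<close> gives
  descriptions of \<open>A\<^bsub>n+1+k\<^esub>\<close> on \<open>[w]\<close> by \<open>C\<^sub>1\<close> and by \<open>C\<^sub>2\<close>, and of \<open>A\<^bsub>n+1+3k\<^esub>\<close> by \<open>C\<^sub>3\<close>, where the \<open>C\<^sub>i\<close> are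
  preimages of \<open>C\<close> under the labels.  The first two describe the same set, so \<open>C\<^sub>1\<close> and \<open>C\<^sub>2\<close> nearly
  agree.  Since \<open>q*\<close> has the inverse label of \<open>q\<close>, the element \<open>L(q)\<inverse> L(p)\<close> pulls the pair
  \<open>(C\<^sub>2, C\<^sub>1)\<close> back to \<open>(C\<^sub>1, C\<^sub>3)\<close>, so \<open>C\<^sub>1\<close> and \<open>C\<^sub>3\<close> nearly agree too, and hence so do \<open>A\<^sub>m\<close> and
  \<open>A\<^bsub>m+2k\<^esub>\<close> on \<open>[w]\<close> for \<open>m = n + 1 + k\<close> (\<open>gap_good_vertex\<close>).  Irreducibility carries this from
  \<open>[w]\<close> to all cylinders (\<open>gap_every_vertex\<close>).  Finally \<open>A\<close> differs from \<open>T\<^sup>-\<^sup>2\<^sup>k A\<close> by the preimage of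
  the difference of \<open>A\<^sub>m\<close> and \<open>A\<^bsub>m+2k\<^esub>\<close> under \<open>T\<^bsup>m+2k\<^esup>\<close>, and \<open>T\<close> preserves the measure; letting \<open>m\<close>
  tend to infinity, the difference is a null set (\<open>AE_invariant\<close>).
\<close>

section \<open>Saturated sets, averages and paths\<close>

lemma saturated_sets_iff:
  assumes "R \<subseteq> space K \<times> space K" "\<And>z. z \<in> space K \<Longrightarrow> (z, z) \<in> R" "sym R" "trans R"
  shows "A \<in> saturated_sets K R \<longleftrightarrow> A \<in> sets K \<and> (\<forall>z z'. (z, z') \<in> R \<longrightarrow> z \<in> A \<longrightarrow> z' \<in> A)"
    (is "?l \<longleftrightarrow> ?r")
proof
  assume ?l
  then obtain C where C: "A \<in> sets K" "C \<subseteq> space K // R" "A = \<Union>C"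
    by (auto simp: saturated_sets_def)
  have "z' \<in> A" if "(z, z') \<in> R" "z \<in> A" for z z'
  proof -
    from that(2) C(3) obtain c where c: "c \<in> C" "z \<in> c" by blast
    with C(2) obtain w where "c = R `` {w}" by (auto simp: quotient_def)
    with c that(1) have "z' \<in> c" using transD[OF assms(4)] by blast
    then show ?thesis using c C by blast
  qed
  with C(1) show ?r by blast
next
  assume r: ?r
  have "A = \<Union>((\<lambda>z. R `` {z}) ` A)"
    using r assms(2) sets.sets_into_space[of A K] by blast
  moreover have "(\<lambda>z. R `` {z}) ` A \<subseteq> space K // R"
    using r sets.sets_into_space[of A K] by (auto simp: quotient_def)
  ultimately show ?l
    using r unfolding saturated_sets_def by blast
qed

lemma exists_le_average:
  fixes p h :: "'v::finite \<Rightarrow> real"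
  assumes "\<And>v. p v \<ge> 0" "(\<Sum>v\<in>UNIV. p v) = 1"
  shows "\<exists>v. h v \<le> (\<Sum>v\<in>UNIV. p v * h v)"
proof -
  have "Min (range h) \<in> range h" by (rule Min_in) auto
  then obtain v where v: "Min (range h) = h v" by blast
  then have "h v \<le> h u" for u using Min_le[of "range h" "h u"] by simp
  then have "(\<Sum>u\<in>UNIV. p u * h v) \<le> (\<Sum>u\<in>UNIV. p u * h u)"
    using assms(1) by (intro sum_mono mult_left_mono) auto
  then have "h v \<le> (\<Sum>u\<in>UNIV. p u * h u)"
    using assms(2) by (simp add: sum_distrib_right[symmetric])
  then show ?thesis by blast
qed

lemma path_of_rtrancl:
  "(v, w) \<in> (edges P)\<^sup>* \<Longrightarrow> \<exists>b. directed_path P (b @ [w]) \<and> hd (b @ [w]) = v"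
proof (induction rule: converse_rtrancl_induct)
  case base
  then show ?case by (intro exI[of _ "[]"]) (simp add: directed_path_def)
next
  case (step u v)
  then obtain b where "directed_path P (b @ [w])" "hd (b @ [w]) = v" by blast
  with step(1) show ?case
    by (intro exI[of _ "u # b"]) (simp add: directed_path_def successively_Cons)
qed

section \<open>Labels of paths and the skew shift\<close>

lemma path_label_simps:
  "path_label F L [] = \<one>\<^bsub>F\<^esub>" "path_label F L (v # p) = L v \<otimes>\<^bsub>F\<^esub> path_label F L p"
  by (simp_all add: path_label_def gprod_def)

lemma seqs_iff: "s \<in> seqs \<longleftrightarrow> s 0 = undefined"
proof -
  have "i \<notin> {1..} \<longleftrightarrow> i = (0::nat)" for i by auto
  then show ?thesis
    by (auto simp: seq_algebra_def space_PiM PiE_def extensional_def)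
qed

text \<open>
  Index \<open>0\<close> carries no entry, so both operations reset it to \<open>undefined\<close> in order to stay in
  the sequence space.
\<close>

definition shift :: "(nat \<Rightarrow> 'v) \<Rightarrow> nat \<Rightarrow> 'v" where
  "shift s = (\<lambda>i. if i = 0 then undefined else s (Suc i))"

definition cons_seq :: "'v \<Rightarrow> (nat \<Rightarrow> 'v) \<Rightarrow> nat \<Rightarrow> 'v" where
  "cons_seq v s = (\<lambda>i. if i = 0 then undefined else if i = 1 then v else s (i - 1))"

lemma shift_in_seqs [simp]: "shift s \<in> seqs"
  by (simp add: seqs_iff shift_def)

lemma cons_seq_in_seqs [simp]: "cons_seq v s \<in> seqs"
  by (simp add: seqs_iff cons_seq_def)

lemma shift_cons_seq [simp]: "s \<in> seqs \<Longrightarrow> shift (cons_seq v s) = s"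
  by (auto simp: seqs_iff shift_def cons_seq_def)

lemma cons_seq_shift [simp]: "s \<in> seqs \<Longrightarrow> cons_seq (s 1) (shift s) = s"
  by (auto simp: seqs_iff shift_def cons_seq_def fun_eq_iff)

lemma cons_seq_1 [simp]: "cons_seq v s (Suc 0) = v"
  by (simp add: cons_seq_def)

lemma measurable_seq_algebraI:
  assumes "\<And>i. i \<ge> 1 \<Longrightarrow> (\<lambda>z. f z i) \<in> measurable K (count_space UNIV)"
    and "\<And>z. z \<in> space K \<Longrightarrow> f z 0 = undefined"
  shows "f \<in> measurable K seq_algebra"
proof -
  have "i \<notin> {1..} \<longleftrightarrow> i = (0::nat)" for i by auto
  then show ?thesis
    unfolding seq_algebra_def using assms
    by (intro measurable_PiM_single')
       (auto simp: PiE_def extensional_def Pi_def)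
qed

lemma measurable_coordinate:
  "i \<ge> 1 \<Longrightarrow> (\<lambda>s. s i) \<in> measurable seq_algebra (count_space UNIV)"
  unfolding seq_algebra_def by (rule measurable_component_singleton) auto

locale skew_product =
  fixes F :: "('g, 'b) monoid_scheme"
    and L :: "'v::finite \<Rightarrow> 'g"
    and P :: "'v \<Rightarrow> 'v \<Rightarrow> real"
    and \<nu> :: "'v \<Rightarrow> real"
    and N :: "(nat \<Rightarrow> 'v) measure"
    and M :: "'x measure"
    and \<phi> :: "'g \<Rightarrow> 'x \<Rightarrow> 'x"
  assumes group_F: "group F"
    and L_closed [simp]: "\<And>v. L v \<in> carrier F"
    and stochastic: "stochastic_matrix P"
    and \<nu>_pos: "\<And>v. \<nu> v > 0"
    and path_measure: "is_path_measure P \<nu> N"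
    and prob_M: "prob_space M"
    and action: "measure_preserving_action F M \<phi>"
begin

sublocale F: group F by (rule group_F)
sublocale N: prob_space N using path_measure by (simp add: is_path_measure_def)
sublocale M: prob_space M by (rule prob_M)
sublocale Q: pair_prob_space N M ..
sublocale act: group_action F "space M" \<phi>
  using action by (simp add: measure_preserving_action_def)

abbreviation "Q \<equiv> N \<Otimes>\<^sub>M M"

text \<open>
  The skew shift.  It is the inverse of the label that acts, because points are compared through
  the cocycle \<open>L(t\<^sub>1) \<cdots> L(t\<^sub>n) (L(s\<^sub>1) \<cdots> L(s\<^sub>n))\<inverse>\<close>: undoing the labels on both sides turns the
  cocycle condition into equality.
\<close>

definition T :: "(nat \<Rightarrow> 'v) \<times> 'x \<Rightarrow> (nat \<Rightarrow> 'v) \<times> 'x" where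
  "T z = (shift (fst z), \<phi> (inv\<^bsub>F\<^esub> (L (fst z 1))) (snd z))"

lemma T_pair: "T (s, x) = (shift s, \<phi> (inv\<^bsub>F\<^esub> (L (s 1))) x)"
  by (simp add: T_def)

text \<open>
  The branches of the inverse of \<open>T\<close>.  They are defined for all \<open>v\<close>, whether or not prepending
  \<open>v\<close> extends a path, just as the equivalence relations live on all sequences.
\<close>

definition S :: "'v \<Rightarrow> (nat \<Rightarrow> 'v) \<times> 'x \<Rightarrow> (nat \<Rightarrow> 'v) \<times> 'x" where
  "S v z = (cons_seq v (fst z), \<phi> (L v) (snd z))"

abbreviation label :: "'v list \<Rightarrow> 'g" where
  "label \<equiv> path_label F L"

lemma label_closed [simp]: "label p \<in> carrier F"
  by (induction p) (auto simp: path_label_simps)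

lemma label_append: "label (p @ q) = label p \<otimes>\<^bsub>F\<^esub> label q"
  by (induction p) (auto simp: path_label_simps F.m_assoc)

lemma act_closed [simp]: "g \<in> carrier F \<Longrightarrow> x \<in> space M \<Longrightarrow> \<phi> g x \<in> space M"
  using act.element_image by blast

lemma act_mult: "g \<in> carrier F \<Longrightarrow> h \<in> carrier F \<Longrightarrow> x \<in> space M \<Longrightarrow> \<phi> (g \<otimes>\<^bsub>F\<^esub> h) x = \<phi> g (\<phi> h x)"
  by (rule act.composition_rule)

lemma act_one [simp]: "x \<in> space M \<Longrightarrow> \<phi> \<one>\<^bsub>F\<^esub> x = x"
  by (metis act.id_eq_one restrict_apply')

lemma act_inv [simp]:
  assumes "g \<in> carrier F" "x \<in> space M"
  shows "\<phi> (inv\<^bsub>F\<^esub> g) (\<phi> g x) = x" "\<phi> g (\<phi> (inv\<^bsub>F\<^esub> g) x) = x"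
  using assms act_mult[of "inv\<^bsub>F\<^esub> g" g x] act_mult[of g "inv\<^bsub>F\<^esub> g" x] by auto

lemma act_measurable: "g \<in> carrier F \<Longrightarrow> \<phi> g \<in> measurable M M"
  using action by (simp add: measure_preserving_action_def)

lemma measure_act_vimage:
  assumes "g \<in> carrier F" "C \<in> sets M"
  shows "measure M {x \<in> space M. \<phi> g x \<in> C} = measure M C"
proof -
  have "measure M C = measure (distr M M (\<phi> g)) C"
    using assms action by (simp add: measure_preserving_action_def)
  also have "\<dots> = measure M {x \<in> space M. \<phi> g x \<in> C}"
    using assms act_measurable
    by (subst measure_distr) (auto intro!: arg_cong[where f = "measure M"])
  finally show ?thesis ..
qed

lemma sets_N: "sets N = sets seq_algebra"
  using path_measure by (simp add: is_path_measure_def)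

lemma space_N: "space N = seqs"
  using sets_eq_imp_space_eq[OF sets_N] .

lemma space_Q: "space Q = seqs \<times> space M"
  by (simp add: space_pair_measure space_N)

lemma fst_in_seqs [simp]: "z \<in> space Q \<Longrightarrow> fst z \<in> seqs"
  and snd_in_space [simp]: "z \<in> space Q \<Longrightarrow> snd z \<in> space M"
  by (auto simp: space_Q)

lemma T_closed [simp]: "z \<in> space Q \<Longrightarrow> T z \<in> space Q"
  and S_closed [simp]: "z \<in> space Q \<Longrightarrow> S v z \<in> space Q"
  by (auto simp: space_Q T_def S_def)

lemma T_S [simp]: "z \<in> space Q \<Longrightarrow> T (S v z) = z"
  by (auto simp: space_Q T_def S_def)

lemma S_T [simp]: "z \<in> space Q \<Longrightarrow> S (fst z 1) (T z) = z"
  by (auto simp: space_Q T_def S_def simp del: One_nat_def)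

lemma T_funpow_closed [simp]: "z \<in> space Q \<Longrightarrow> (T ^^ n) z \<in> space Q"
  by (induction n) auto

lemma T_funpow_add: "(T ^^ (a + b)) z = (T ^^ a) ((T ^^ b) z)"
  by (simp add: funpow_add)

lemma measurable_fst_coordinate [measurable]:
  "i \<ge> 1 \<Longrightarrow> (\<lambda>z. fst z i) \<in> measurable Q (count_space UNIV)"
proof -
  assume i: "i \<ge> 1"
  have "(\<lambda>s. s i) \<in> measurable N (count_space UNIV)"
    using measurable_coordinate[OF i] measurable_cong_sets[OF sets_N refl] by blast
  from measurable_compose[OF measurable_fst this] show ?thesis .
qed

text \<open>
  The measure \<open>N\<close> agrees with the sequence space only in its sets; this criterion
  reduces measurability into the product to single coordinates.
\<close>

lemma measurable_into_Q:
  assumes "\<And>i. i \<ge> 1 \<Longrightarrow> (\<lambda>z. fst (f z) i) \<in> measurable K (count_space UNIV)"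
    and "\<And>z. z \<in> space K \<Longrightarrow> fst (f z) \<in> seqs"
    and "(\<lambda>z. snd (f z)) \<in> measurable K M"
  shows "f \<in> measurable K Q"
proof (rule measurable_pair)
  have "(\<lambda>z. fst (f z)) \<in> measurable K seq_algebra"
    using assms(1,2) by (intro measurable_seq_algebraI) (auto simp: seqs_iff)
  then show "fst \<circ> f \<in> measurable K N"
    using measurable_cong_sets[OF refl sets_N, of K] by (simp add: comp_def)
qed (use assms in \<open>simp add: comp_def\<close>)

lemma measurable_S [measurable]: "S v \<in> measurable Q Q"
proof (rule measurable_into_Q)
  fix i :: nat assume "i \<ge> 1"
  then show "(\<lambda>z. fst (S v z) i) \<in> measurable Q (count_space UNIV)"
    by (cases "i = 1") (auto simp: S_def cons_seq_def intro!: measurable_fst_coordinate)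
next
  show "(\<lambda>z. snd (S v z)) \<in> measurable Q M"
    using measurable_compose[OF measurable_snd act_measurable[OF L_closed]] by (simp add: S_def)
qed (auto simp: S_def)

lemma measurable_T [measurable]: "T \<in> measurable Q Q"
proof (rule measurable_into_Q)
  fix i :: nat assume "i \<ge> 1"
  then show "(\<lambda>z. fst (T z) i) \<in> measurable Q (count_space UNIV)"
    by (auto simp: T_def shift_def intro!: measurable_fst_coordinate)
next
  have "(\<lambda>z. \<phi> (inv\<^bsub>F\<^esub> (L (fst z 1))) (snd z)) \<in> measurable Q M"
  proof (rule measurable_compose_countable)
    show "(\<lambda>z. fst z 1) \<in> measurable Q (count_space UNIV)"
      by (rule measurable_fst_coordinate) simp
    show "(\<lambda>z. \<phi> (inv\<^bsub>F\<^esub> (L v)) (snd z)) \<in> measurable Q M" for v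
      by (rule measurable_compose[OF measurable_snd act_measurable]) simp
  qed
  then show "(\<lambda>z. snd (T z)) \<in> measurable Q M"
    by (simp add: T_def)
qed (auto simp: T_def)

lemma measurable_T_funpow [measurable]: "(T ^^ n) \<in> measurable Q Q"
  by (induction n) (auto intro: measurable_comp measurable_T simp: id_def)

lemma sets_vimage:
  assumes "f \<in> measurable Q Q" "E \<in> sets Q"
  shows "{z \<in> space Q. f z \<in> E} \<in> sets Q"
  using measurable_sets[OF assms] by (simp add: vimage_def Int_def conj_commute)

lemma sets_restrict_coordinate:
  assumes "E \<in> sets Q" "i \<ge> 1"
  shows "{z \<in> E. fst z i = v} \<in> sets Q"
proof -
  have "{z \<in> E. fst z i = v} = E \<inter> ((\<lambda>z. fst z i) -` {v} \<inter> space Q)"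
    using sets.sets_into_space[OF assms(1)] by auto
  then show ?thesis
    using measurable_sets[OF measurable_fst_coordinate[OF assms(2)], of "{v}"] assms by auto
qed

section \<open>The two equivalence relations in terms of the skew shift\<close>

lemma T_funpow:
  assumes "s \<in> seqs" "x \<in> space M"
  shows "(T ^^ n) (s, x) = ((\<lambda>i. if i = 0 then undefined else s (n + i)),
           \<phi> (inv\<^bsub>F\<^esub> (label (map s [1..<Suc n]))) x)"
proof (induction n)
  case 0
  then show ?case using assms by (auto simp: seqs_iff path_label_simps)
next
  case (Suc n)
  have l: "label (map s [1..<Suc (Suc n)]) = label (map s [1..<Suc n]) \<otimes>\<^bsub>F\<^esub> L (s (Suc n))"
    by (simp add: label_append path_label_simps)
  have "snd ((T ^^ Suc n) (s, x)) =
      \<phi> (inv\<^bsub>F\<^esub> (L (s (Suc n)))) (\<phi> (inv\<^bsub>F\<^esub> (label (map s [1..<Suc n]))) x)"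
    by (simp add: Suc.IH T_pair del: upt_Suc)
  also have "\<dots> = \<phi> (inv\<^bsub>F\<^esub> (label (map s [1..<Suc (Suc n)]))) x"
    unfolding l using assms by (simp add: act_mult F.inv_mult_group)
  finally have "snd ((T ^^ Suc n) (s, x)) = \<phi> (inv\<^bsub>F\<^esub> (label (map s [1..<Suc (Suc n)]))) x" .
  moreover have "fst ((T ^^ Suc n) (s, x)) = (\<lambda>i. if i = 0 then undefined else s (Suc n + i))"
    by (auto simp: Suc.IH T_pair shift_def fun_eq_iff simp del: upt_Suc)
  ultimately show ?case by (metis prod.collapse)
qed

lemma agree_of_T_funpow:
  assumes eq: "(T ^^ a) (s, x) = (T ^^ b) (t, y)"
    and "s \<in> seqs" "t \<in> seqs" "x \<in> space M" "y \<in> space M" and i: "i > a"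
  shows "s i = t (b + (i - a))"
proof -
  have "fst ((T ^^ a) (s, x)) (i - a) = fst ((T ^^ b) (t, y)) (i - a)"
    by (simp add: eq)
  then show ?thesis
    using assms(2-5) i by (simp add: T_funpow del: upt_Suc One_nat_def)
qed

text \<open>
  The labels can be moved to their own sides because the group acts by bijections.  The shift
  \<open>p\<close> becomes the difference of the two exponents, so the ambiguity of the cocycle on eventually
  periodic sequences becomes the freedom to choose the exponents.
\<close>

lemma cocycle_iff_orbits_meet:
  assumes s: "s \<in> seqs" and t: "t \<in> seqs" and x: "x \<in> space M" and y: "y \<in> space M"
  shows "(\<exists>g. cocycle_val F L p t s g \<and> \<phi> g x = y) \<longleftrightarrow>
    (\<exists>a b. int b = int a + p \<and> (T ^^ a) (s, x) = (T ^^ b) (t, y))"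
proof
  assume "\<exists>g. cocycle_val F L p t s g \<and> \<phi> g x = y"
  then obtain n where n: "n \<ge> 1" "int n + p \<ge> 1" "\<forall>i\<ge>n. t (nat (p + int i)) = s i"
    and eq: "\<phi> (label (map t [1..<Suc (nat (int n + p))]) \<otimes>\<^bsub>F\<^esub>
               inv\<^bsub>F\<^esub> (label (map s [1..<Suc n]))) x = y"
    unfolding cocycle_val_def shift_agree_def by blast
  define b where "b = nat (int n + p)"
  have b: "int b = int n + p" using n by (simp add: b_def)
  have "t (b + i) = s (n + i)" for i
  proof -
    have "nat (p + int (n + i)) = b + i" using b by simp
    then show ?thesis using n(3) by (metis le_add1)
  qed
  moreover have "\<phi> (inv\<^bsub>F\<^esub> (label (map s [1..<Suc n]))) x
      = \<phi> (inv\<^bsub>F\<^esub> (label (map t [1..<Suc b]))) y"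
    using eq x unfolding b_def[symmetric] by (auto simp: act_mult)
  ultimately have "(T ^^ n) (s, x) = (T ^^ b) (t, y)"
    unfolding T_funpow[OF s x] T_funpow[OF t y] by (simp add: fun_eq_iff)
  then show "\<exists>a b. int b = int a + p \<and> (T ^^ a) (s, x) = (T ^^ b) (t, y)"
    using b by blast
next
  assume "\<exists>a b. int b = int a + p \<and> (T ^^ a) (s, x) = (T ^^ b) (t, y)"
  then obtain a b where "int b = int a + p" "(T ^^ a) (s, x) = (T ^^ b) (t, y)" by blast
  \<comment> \<open>One more step makes the sequences agree from the last index of the labels on.\<close>
  then have p: "int (Suc b) = int (Suc a) + p" and "(T ^^ Suc a) (s, x) = (T ^^ Suc b) (t, y)"
    and eq: "(T ^^ a) (s, x) = (T ^^ b) (t, y)"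
    by auto
  then have x': "\<phi> (inv\<^bsub>F\<^esub> (label (map s [1..<Suc (Suc a)]))) x
      = \<phi> (inv\<^bsub>F\<^esub> (label (map t [1..<Suc (Suc b)]))) y"
    unfolding T_funpow[OF s x] T_funpow[OF t y] by blast
  have "t (nat (p + int i)) = s i" if "i \<ge> Suc a" for i
  proof -
    have "nat (p + int i) = b + (i - a)" using p that by simp
    then show ?thesis using agree_of_T_funpow[OF eq s t x y, of i] that by simp
  qed
  then have "shift_agree p (Suc a) t s"
    using p unfolding shift_agree_def by simp
  moreover have "nat (int (Suc a) + p) = Suc b" using p by simp
  moreover have "\<phi> (label (map t [1..<Suc (Suc b)]) \<otimes>\<^bsub>F\<^esub>
      inv\<^bsub>F\<^esub> (label (map s [1..<Suc (Suc a)]))) x = y"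
    using x y x' by (simp add: act_mult del: upt_Suc)
  ultimately show "\<exists>g. cocycle_val F L p t s g \<and> \<phi> g x = y"
    unfolding cocycle_val_def by metis
qed

lemma R_sync_skew_iff:
  "(z, z') \<in> R_sync_skew F L M \<phi> \<longleftrightarrow>
     z \<in> space Q \<and> z' \<in> space Q \<and> (\<exists>n. (T ^^ n) z = (T ^^ n) z')"
proof -
  obtain s x t y where z: "z = (s, x)" "z' = (t, y)" by fastforce
  have "(s, t) \<in> R_sync" if h: "s \<in> seqs" "t \<in> seqs" "x \<in> space M" "y \<in> space M"
    and eq: "(T ^^ n) (s, x) = (T ^^ n) (t, y)" for n
    unfolding R_sync_def using h agree_of_T_funpow[OF eq h]
    by (auto intro!: exI[of _ "Suc n"])
  moreover have "s \<in> seqs \<and> t \<in> seqs" if "(s, t) \<in> R_sync"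
    using that by (simp add: R_sync_def)
  ultimately show ?thesis
    unfolding R_sync_skew_def skew_relation_def z space_Q
    using cocycle_iff_orbits_meet[of s t x y 0] by auto
qed

lemma R_tail_skew_iff:
  "(z, z') \<in> R_tail_skew F L M \<phi> m \<longleftrightarrow>
     z \<in> space Q \<and> z' \<in> space Q \<and>
     (\<exists>a b. int m dvd int b - int a \<and> (T ^^ a) z = (T ^^ b) z')"
proof -
  obtain s x t y where z: "z = (s, x)" "z' = (t, y)" by fastforce
  have R: "(s, t) \<in> R_tail m" if h: "s \<in> seqs" "t \<in> seqs" "x \<in> space M" "y \<in> space M"
    and eq: "(T ^^ a) (s, x) = (T ^^ b) (t, y)" and d: "int m dvd int b - int a" for a b
  proof -
    from d have "int m dvd int a - int b" by (simp add: dvd_diff_commute)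
    then obtain r where r: "int a - int b = r * int m" by (metis dvd_def mult.commute)
    have "s (nat (r * int m + int i)) = t i" if "i \<ge> Suc b" for i
    proof -
      have "nat (r * int m + int i) = a + (i - b)" using that r by linarith
      then show ?thesis
        using agree_of_T_funpow[OF eq[symmetric] h(2,1,4,3), of i] that by simp
    qed
    then have "shift_agree (r * int m) (Suc b) s t"
      using r unfolding shift_agree_def by simp
    then show ?thesis using h unfolding R_tail_def by blast
  qed
  have D: "(\<exists>p\<in>{r * int m |r. True}. \<exists>a b. int b = int a + p \<and> (T ^^ a) (s, x) = (T ^^ b) (t, y))
      \<longleftrightarrow> (\<exists>a b. int m dvd int b - int a \<and> (T ^^ a) (s, x) = (T ^^ b) (t, y))" (is "?l \<longleftrightarrow> ?r")
  proof
    assume ?l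
    then obtain r a b where r: "int b = int a + r * int m" and eq: "(T ^^ a) (s, x) = (T ^^ b) (t, y)"
      by blast
    from r have "int m dvd int b - int a" by simp
    with eq show ?r by blast
  next
    assume ?r
    then obtain a b r where "int b - int a = r * int m" "(T ^^ a) (s, x) = (T ^^ b) (t, y)"
      by (metis dvd_def mult.commute)
    then have "int b = int a + r * int m" "(T ^^ a) (s, x) = (T ^^ b) (t, y)" by auto
    then show ?l by blast
  qed
  show ?thesis
  proof (cases "s \<in> seqs \<and> t \<in> seqs \<and> x \<in> space M \<and> y \<in> space M")
    case True
    then have "(\<exists>p\<in>{r * int m |r. True}. \<exists>g. cocycle_val F L p t s g \<and> \<phi> g x = y) \<longleftrightarrow>
        (\<exists>a b. int m dvd int b - int a \<and> (T ^^ a) (s, x) = (T ^^ b) (t, y))"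
      using cocycle_iff_orbits_meet[of s t x y] D by simp
    then show ?thesis
      using True R unfolding R_tail_skew_def skew_relation_def z space_Q by auto
  next
    case False
    then show ?thesis
      unfolding R_tail_skew_def skew_relation_def z space_Q R_tail_def by auto
  qed
qed

lemma F_sync_iff:
  "A \<in> F_sync F L N M \<phi> \<longleftrightarrow> A \<in> sets Q \<and>
     (\<forall>z\<in>space Q. \<forall>z'\<in>space Q. \<forall>n. (T ^^ n) z = (T ^^ n) z' \<longrightarrow> z \<in> A \<longrightarrow> z' \<in> A)"
proof -
  let ?R = "R_sync_skew F L M \<phi>"
  have "trans ?R"
  proof (rule transI)
    fix z z' z'' assume *: "(z, z') \<in> ?R" "(z', z'') \<in> ?R"
    then obtain n m where "(T ^^ n) z = (T ^^ n) z'" "(T ^^ m) z' = (T ^^ m) z''"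
      by (auto simp: R_sync_skew_iff)
    then have "(T ^^ (m + n)) z = (T ^^ (m + n)) z''"
      using T_funpow_add[of m n z] T_funpow_add[of m n z'] T_funpow_add[of n m z']
        T_funpow_add[of n m z''] by (simp add: add.commute)
    then show "(z, z'') \<in> ?R" using * unfolding R_sync_skew_iff by blast
  qed
  moreover have "sym ?R"
    by (rule symI) (metis R_sync_skew_iff)
  moreover have "(z, z) \<in> ?R" if "z \<in> space Q" for z
    unfolding R_sync_skew_iff using that by blast
  moreover have "?R \<subseteq> space Q \<times> space Q"
    by (auto simp: R_sync_skew_iff)
  ultimately show ?thesis
    unfolding F_sync_def by (subst saturated_sets_iff) (assumption | unfold R_sync_skew_iff, blast)+
qed

lemma F_tail_iff:
  "A \<in> F_tail F L N M \<phi> m \<longleftrightarrow> A \<in> sets Q \<and>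
     (\<forall>z\<in>space Q. \<forall>z'\<in>space Q. \<forall>a b. int m dvd int b - int a \<longrightarrow> (T ^^ a) z = (T ^^ b) z' \<longrightarrow>
        z \<in> A \<longrightarrow> z' \<in> A)"
proof -
  let ?R = "R_tail_skew F L M \<phi> m"
  have "trans ?R"
  proof (rule transI)
    fix z z' z'' assume *: "(z, z') \<in> ?R" "(z', z'') \<in> ?R"
    then obtain a b c d where d: "int m dvd int b - int a" "int m dvd int d - int c"
      and T: "(T ^^ a) z = (T ^^ b) z'" "(T ^^ c) z' = (T ^^ d) z''"
      by (auto simp: R_tail_skew_iff)
    from T have "(T ^^ (c + a)) z = (T ^^ (b + d)) z''"
      using T_funpow_add[of c a z] T_funpow_add[of b c z'] T_funpow_add[of c b z'] T_funpow_add[of b d z'']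
      by (simp add: add.commute)
    moreover have "int m dvd int (b + d) - int (c + a)"
      using dvd_add[OF d] by (simp add: algebra_simps)
    ultimately show "(z, z'') \<in> ?R" using * unfolding R_tail_skew_iff by blast
  qed
  moreover have "sym ?R"
  proof (rule symI)
    fix z z' assume "(z, z') \<in> ?R"
    then show "(z', z) \<in> ?R"
      unfolding R_tail_skew_iff by (metis dvd_diff_commute)
  qed
  moreover have "(z, z) \<in> ?R" if "z \<in> space Q" for z
    unfolding R_tail_skew_iff using that by (metis diff_self dvd_0_right)
  moreover have "?R \<subseteq> space Q \<times> space Q"
    by (auto simp: R_tail_skew_iff)
  ultimately show ?thesis
    unfolding F_tail_def by (subst saturated_sets_iff) (assumption | unfold R_tail_skew_iff, blast)+
qed

section \<open>Sets that depend on finitely many coordinates\<close>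

abbreviation slab :: "'x set \<Rightarrow> ((nat \<Rightarrow> 'v) \<times> 'x) set" where
  "slab C \<equiv> seqs \<times> C"

definition finitary :: "nat \<Rightarrow> ((nat \<Rightarrow> 'v) \<times> 'x) set \<Rightarrow> bool" where
  "finitary n B \<longleftrightarrow> B \<in> sets Q \<and>
     (\<forall>s\<in>seqs. \<forall>t\<in>seqs. \<forall>x. (\<forall>i\<in>{1..n}. s i = t i) \<longrightarrow> ((s, x) \<in> B \<longleftrightarrow> (t, x) \<in> B))"

lemma slab_in_sets [simp]: "C \<in> sets M \<Longrightarrow> slab C \<in> sets Q"
  using sets.top[of N] by (simp add: space_N pair_measureI)

lemma sets_M_vimage: "g \<in> carrier F \<Longrightarrow> C \<in> sets M \<Longrightarrow> {x \<in> space M. \<phi> g x \<in> C} \<in> sets M"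
  using measurable_sets[OF act_measurable, of g C] by (simp add: vimage_def Int_def conj_commute)

lemma finitary_in_sets: "finitary n B \<Longrightarrow> B \<in> sets Q"
  by (simp add: finitary_def)

lemma finitaryD:
  "finitary n B \<Longrightarrow> s \<in> seqs \<Longrightarrow> t \<in> seqs \<Longrightarrow> (\<And>i. i \<in> {1..n} \<Longrightarrow> s i = t i) \<Longrightarrow>
     (s, x) \<in> B \<longleftrightarrow> (t, x) \<in> B"
  unfolding finitary_def by blast

lemma finitaryI:
  assumes "B \<in> sets Q"
    and "\<And>s t x. s \<in> seqs \<Longrightarrow> t \<in> seqs \<Longrightarrow> (\<And>i. i \<in> {1..n} \<Longrightarrow> s i = t i) \<Longrightarrow>
      (s, x) \<in> B \<longleftrightarrow> (t, x) \<in> B"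
  shows "finitary n B"
  unfolding finitary_def using assms by blast

lemma finitary_mono:
  assumes "finitary n B" "n \<le> m"
  shows "finitary m B"
proof (rule finitaryI[OF finitary_in_sets[OF assms(1)]])
  fix s t :: "nat \<Rightarrow> 'v" and x
  assume st: "s \<in> seqs" "t \<in> seqs" and eq: "\<And>i. i \<in> {1..m} \<Longrightarrow> s i = t i"
  show "(s, x) \<in> B \<longleftrightarrow> (t, x) \<in> B"
    using st by (rule finitaryD[OF assms(1)]) (use eq assms(2) in auto)
qed

lemma finitary_Un:
  assumes "finitary n A" "finitary n B"
  shows "finitary n (A \<union> B)"
  by (rule finitaryI)
     (use assms finitary_in_sets finitaryD[OF assms(1)] finitaryD[OF assms(2)] in \<open>blast+\<close>)

lemma finitary_compl:
  assumes "finitary n B"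
  shows "finitary n (space Q - B)"
proof (rule finitaryI)
  show "space Q - B \<in> sets Q" using finitary_in_sets[OF assms] by (rule sets.compl_sets)
next
  fix s t :: "nat \<Rightarrow> 'v" and x
  assume "s \<in> seqs" "t \<in> seqs" "\<And>i. i \<in> {1..n} \<Longrightarrow> s i = t i"
  then show "(s, x) \<in> space Q - B \<longleftrightarrow> (t, x) \<in> space Q - B"
    using finitaryD[OF assms, of s t x] by (simp add: space_Q)
qed

lemma finitary_Int:
  assumes "finitary n A" "finitary n B"
  shows "finitary n (A \<inter> B)"
  by (rule finitaryI)
     (use assms finitary_in_sets finitaryD[OF assms(1)] finitaryD[OF assms(2)] in \<open>blast+\<close>)

lemma finitary_slab: "C \<in> sets M \<Longrightarrow> finitary 0 (slab C)"
  by (rule finitaryI) (simp_all add: slab_in_sets)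

lemma finitary_0_imp_slab:
  assumes "finitary 0 B"
  shows "\<exists>C\<in>sets M. B = slab C"
proof -
  define s0 :: "nat \<Rightarrow> 'v" where "s0 = (\<lambda>_. undefined)"
  have s0: "s0 \<in> seqs" by (simp add: seqs_iff s0_def)
  have "B \<subseteq> space Q" using assms finitary_in_sets sets.sets_into_space by blast
  moreover have "(s, x) \<in> B \<longleftrightarrow> (s0, x) \<in> B" if "s \<in> seqs" for s x
    using that s0 by (intro finitaryD[OF assms]) auto
  ultimately have "B = slab (Pair s0 -` B)"
    by (auto simp: space_Q)
  moreover have "Pair s0 -` B \<in> sets M"
    using assms finitary_in_sets by (intro sets_Pair1)
  ultimately show ?thesis by blast
qed

lemma finitary_coordinate: "i \<ge> 1 \<Longrightarrow> finitary i {z \<in> space Q. fst z i = v}"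
  using sets_restrict_coordinate[OF sets.top] by (intro finitaryI) (simp_all add: space_Q)

lemma finitary_vimage_S:
  assumes "finitary (Suc n) B"
  shows "finitary n {z \<in> space Q. S v z \<in> B}"
proof (rule finitaryI)
  show "{z \<in> space Q. S v z \<in> B} \<in> sets Q"
    by (rule sets_vimage[OF measurable_S finitary_in_sets[OF assms]])
next
  fix s t :: "nat \<Rightarrow> 'v" and x
  assume st: "s \<in> seqs" "t \<in> seqs" and eq: "\<And>i. i \<in> {1..n} \<Longrightarrow> s i = t i"
  have "cons_seq v s i = cons_seq v t i" if "i \<in> {1..Suc n}" for i
  proof (cases "i = 1")
    case False
    then have "i - 1 \<in> {1..n}" using that by auto
    then show ?thesis using False that eq[of "i - 1"] by (simp add: cons_seq_def)
  qed (simp add: cons_seq_def)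
  then have "(cons_seq v s, y) \<in> B \<longleftrightarrow> (cons_seq v t, y) \<in> B" for y
    by (intro finitaryD[OF assms]) auto
  then show "(s, x) \<in> {z \<in> space Q. S v z \<in> B} \<longleftrightarrow> (t, x) \<in> {z \<in> space Q. S v z \<in> B}"
    using st by (simp add: space_Q S_def)
qed

text \<open>
  The finitary sets form an algebra that generates the product sigma-algebra.  This is used twice:
  to extend the Markov property from cylinders to all sets, and to approximate by finitary sets.
\<close>

lemma sets_Q_eq: "sets Q = sigma_sets (space Q) {B. \<exists>n. finitary n B}" (is "_ = sigma_sets _ ?C")
proof
  show "sigma_sets (space Q) ?C \<subseteq> sets Q"
    by (rule sets.sigma_sets_subset) (use finitary_in_sets in blast)
next
  have C: "?C \<subseteq> Pow (space Q)"
    using finitary_in_sets sets.sets_into_space by blast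
  let ?K = "sigma (space Q) ?C"
  have K: "space ?K = space Q" "sets ?K = sigma_sets (space Q) ?C"
    using C by (simp_all add: sets_measure_of)
  have "(\<lambda>z. z) \<in> measurable ?K Q"
  proof (rule measurable_into_Q)
    fix i :: nat assume i: "i \<ge> 1"
    show "(\<lambda>z. fst z i) \<in> measurable ?K (count_space UNIV)"
    proof (subst measurable_count_space_eq2_countable, intro conjI ballI)
      fix v :: 'v
      have "(\<lambda>z. fst z i) -` {v} \<inter> space ?K = {z \<in> space Q. fst z i = v}"
        unfolding K by auto
      also have "\<dots> \<in> sets ?K"
        unfolding K(2) using finitary_coordinate[OF i] by (intro sigma_sets.Basic) blast
      finally show "(\<lambda>z. fst z i) -` {v} \<inter> space ?K \<in> sets ?K" .
    qed auto
  next
    show "(\<lambda>z. snd z) \<in> measurable ?K M"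
    proof (rule measurableI)
      fix D assume D: "D \<in> sets M"
      have "snd -` D \<inter> space ?K = slab D"
        unfolding K(1) unfolding space_Q using sets.sets_into_space[OF D] by auto
      also have "\<dots> \<in> sets ?K"
        unfolding K(2) using finitary_slab[OF D] by (intro sigma_sets.Basic) blast
      finally show "snd -` D \<inter> space ?K \<in> sets ?K" .
    qed (auto simp: K)
  qed (auto simp: K)
  then have "(\<lambda>z. z) -` A \<inter> space ?K \<in> sets ?K" if "A \<in> sets Q" for A
    using that by (rule measurable_sets)
  then show "sets Q \<subseteq> sigma_sets (space Q) ?C"
    using K sets.sets_into_space[of _ Q] by (fastforce simp: Int_absorb2)
qed

lemma emeasure_split_coordinate:
  assumes K: "sets K = sets Q" and E: "E \<in> sets Q" and i: "i \<ge> 1"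
  shows "emeasure K E = (\<Sum>v\<in>UNIV. emeasure K {z \<in> E. fst z i = v})"
proof -
  have "(\<Sum>v\<in>UNIV. emeasure K {z \<in> E. fst z i = v}) = emeasure K (\<Union>v. {z \<in> E. fst z i = v})"
    using sets_restrict_coordinate[OF E i] K
    by (intro sum_emeasure) (auto simp: disjoint_family_on_def)
  also have "(\<Union>v. {z \<in> E. fst z i = v}) = E" by auto
  finally show ?thesis ..
qed

text \<open>
  The approximable sets form a sigma-algebra: complements have the same symmetric difference, and a
  countable union is approximated by approximating finitely many of its members.
\<close>

lemma finitary_approximation:
  assumes "A \<in> sets Q" "e > 0"
  shows "\<exists>n B. finitary n B \<and> measure Q (sym_diff A B) < e"
proof -
  have "A \<in> sigma_sets (space Q) {B. \<exists>n. finitary n B}"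
    using assms(1) sets_Q_eq by simp
  then show ?thesis using assms(2)
  proof (induction A arbitrary: e rule: sigma_sets.induct)
    case (Basic A)
    then obtain n where "finitary n A" by blast
    then show ?case using Basic(2) by (intro exI[of _ n] exI[of _ A]) simp
  next
    case Empty
    have "finitary 0 {}" by (simp add: finitary_def)
    then show ?case using Empty by (metis Diff_cancel Un_empty measure_empty)
  next
    case (Compl A)
    then obtain n B where B: "finitary n B" "measure Q (sym_diff A B) < e" by blast
    have A: "A \<subseteq> space Q"
      using Compl(1) sets_Q_eq sets.sets_into_space by blast
    have "sym_diff (space Q - A) (space Q - B) = sym_diff A B"
      using A sets.sets_into_space[OF finitary_in_sets[OF B(1)]] by blast
    then show ?case using B finitary_compl by metis
  next
    case (Union A)
    have A: "A i \<in> sets Q" for i using Union(1) sets_Q_eq by simp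
    \<comment> \<open>Finitely many of the sets exhaust the union up to measure \<open>e / 2\<close>.\<close>
    have "(\<lambda>k. measure Q (\<Union>i<k. A i)) \<longlonglongrightarrow> measure Q (\<Union>k. \<Union>i<k. A i)"
    proof (rule Q.P.finite_Lim_measure_incseq)
      show "incseq (\<lambda>k. \<Union>i<k. A i)" by (intro monoI UN_mono) auto
    qed (use A in auto)
    moreover have "(\<Union>k. \<Union>i<k. A i) = (\<Union>i. A i)" by auto
    ultimately have "\<exists>k. \<bar>measure Q (\<Union>i<k. A i) - measure Q (\<Union>i. A i)\<bar> < e / 2"
      using \<open>e > 0\<close> by (metis (no_types) LIMSEQ_D half_gt_zero order_refl real_norm_def)
    then obtain k where k: "\<bar>measure Q (\<Union>i<k. A i) - measure Q (\<Union>i. A i)\<bar> < e / 2" ..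
    have fin: "\<exists>n B. finitary n B \<and> measure Q (sym_diff (\<Union>i<k. A i) B) < d" if "d > 0" for d
      using that
    proof (induction k arbitrary: d)
      case 0
      have "finitary 0 {}" by (simp add: finitary_def)
      then show ?case using 0 by (intro exI[of _ 0] exI[of _ "{}"]) simp
    next
      case (Suc k)
      obtain n B where B: "finitary n B" "measure Q (sym_diff (\<Union>i<k. A i) B) < d / 2"
        using Suc.IH[of "d / 2"] Suc.prems by auto
      obtain m D where D: "finitary m D" "measure Q (sym_diff (A k) D) < d / 2"
        using Union.IH[of "d / 2" k] Suc.prems by auto
      have meas: "sym_diff (\<Union>i<k. A i) B \<in> sets Q" "sym_diff (A k) D \<in> sets Q"
        using A B(1) D(1) finitary_in_sets by auto
      have "measure Q (sym_diff (\<Union>i<Suc k. A i) (B \<union> D))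
          \<le> measure Q (sym_diff (\<Union>i<k. A i) B \<union> sym_diff (A k) D)"
        using meas by (intro Q.P.finite_measure_mono) (auto simp: less_Suc_eq)
      also have "\<dots> \<le> measure Q (sym_diff (\<Union>i<k. A i) B) + measure Q (sym_diff (A k) D)"
        using meas by (rule measure_Un_le)
      finally have "measure Q (sym_diff (\<Union>i<Suc k. A i) (B \<union> D)) < d" using B D by simp
      moreover have "finitary (max n m) (B \<union> D)"
        by (rule finitary_Un[OF finitary_mono[OF B(1)] finitary_mono[OF D(1)]]) simp_all
      ultimately show ?case by blast
    qed
    obtain n B where B: "finitary n B" "measure Q (sym_diff (\<Union>i<k. A i) B) < e / 2"
      using fin[of "e / 2"] \<open>e > 0\<close> by auto
    have meas: "(\<Union>i. A i) \<in> sets Q" "(\<Union>i<k. A i) \<in> sets Q" "B \<in> sets Q"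
      using A B(1) finitary_in_sets by auto
    have "measure Q (sym_diff (\<Union>i. A i) B)
        \<le> measure Q (((\<Union>i. A i) - (\<Union>i<k. A i)) \<union> sym_diff (\<Union>i<k. A i) B)"
      using meas by (intro Q.P.finite_measure_mono) auto
    also have "\<dots> \<le> measure Q ((\<Union>i. A i) - (\<Union>i<k. A i)) + measure Q (sym_diff (\<Union>i<k. A i) B)"
      using meas by (intro measure_Un_le) auto
    also have "measure Q ((\<Union>i. A i) - (\<Union>i<k. A i)) = measure Q (\<Union>i. A i) - measure Q (\<Union>i<k. A i)"
      using meas by (intro Q.P.finite_measure_Diff) auto
    finally have "measure Q (sym_diff (\<Union>i. A i) B) < e" using k B(2) by linarith
    then show ?case using B(1) by blast
  qed
qed

section \<open>The Markov property\<close>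

definition mass :: "'v \<Rightarrow> ((nat \<Rightarrow> 'v) \<times> 'x) set \<Rightarrow> real" where
  "mass v E = measure Q {z \<in> E. fst z 1 = v}"

lemma measure_rectangle:
  "A \<in> sets N \<Longrightarrow> C \<in> sets M \<Longrightarrow> measure Q (A \<times> C) = measure N A * measure M C"
  by (simp add: measure_def M.emeasure_pair_measure_Times enn2real_mult)

lemma cylinder_in_sets: "{s \<in> seqs. \<forall>i\<in>{1..n}. s i = t i} \<in> sets N"
  unfolding sets_N
proof (rule sets.sets_Collect_finite_All)
  fix i assume "i \<in> {1..n}"
  then have "(\<lambda>s. s i) -` {t i} \<inter> seqs \<in> sets seq_algebra"
    by (intro measurable_sets[OF measurable_coordinate]) auto
  then show "{s \<in> seqs. s i = t i} \<in> sets seq_algebra"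
    by (simp add: vimage_def Int_def conj_commute)
qed simp

lemma measure_cylinder:
  "n \<ge> 1 \<Longrightarrow> measure N {s \<in> seqs. \<forall>i\<in>{1..n}. s i = t i} = \<nu> (t n) * (\<Prod>i\<in>{1..<n}. P (t (Suc i)) (t i))"
  using path_measure by (simp add: is_path_measure_def)

text \<open>
  On a cylinder, prepending \<open>v\<close> multiplies the probability by one more transition factor, from
  the first entry \<open>w\<close> to \<open>v\<close>; the action does not change the measure of the second component.
\<close>

lemma markov_cylinder:
  fixes t :: "nat \<Rightarrow> 'v"
  assumes n: "n \<ge> 1" and C: "C \<in> sets M"
  defines "G \<equiv> {s \<in> seqs. \<forall>i\<in>{1..n}. s i = t i} \<times> C"
  shows "measure Q {z \<in> space Q. fst z 1 = v \<and> fst (T z) 1 = w \<and> T z \<in> G} =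
         P w v * measure Q {z \<in> G. fst z 1 = w}"
proof (cases "t 1 = w")
  case False
  then have "{z \<in> space Q. fst z 1 = v \<and> fst (T z) 1 = w \<and> T z \<in> G} = {}" "{z \<in> G. fst z 1 = w} = {}"
    using n unfolding G_def by force+
  then show ?thesis by (simp only: measure_empty mult_zero_right)
next
  case True
  let ?t = "cons_seq v t" and ?C = "{x \<in> space M. \<phi> (inv\<^bsub>F\<^esub> (L v)) x \<in> C}"
  have eq: "s 1 = v \<and> shift s 1 = w \<and> (\<forall>i\<in>{1..n}. shift s i = t i) \<longleftrightarrow>
      (\<forall>i\<in>{1..Suc n}. s i = ?t i)" for s
  proof
    assume a: "s 1 = v \<and> shift s 1 = w \<and> (\<forall>i\<in>{1..n}. shift s i = t i)"
    show "\<forall>i\<in>{1..Suc n}. s i = ?t i"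
    proof
      fix i assume i: "i \<in> {1..Suc n}"
      show "s i = ?t i"
      proof (cases "i = 1")
        case False
        then have "i - 1 \<in> {1..n}" using i by auto
        with a have "shift s (i - 1) = t (i - 1)" by blast
        then show ?thesis using False i by (simp add: shift_def cons_seq_def)
      qed (use a in \<open>simp add: cons_seq_def\<close>)
    qed
  next
    assume a: "\<forall>i\<in>{1..Suc n}. s i = ?t i"
    have "shift s i = t i" if "i \<in> {1..n}" for i
      using a[rule_format, of "Suc i"] that by (simp add: shift_def cons_seq_def)
    moreover have "s 1 = v" using a[rule_format, of 1] by (simp add: cons_seq_def)
    ultimately show "s 1 = v \<and> shift s 1 = w \<and> (\<forall>i\<in>{1..n}. shift s i = t i)"
      using True n by auto
  qed
  have "{z \<in> space Q. fst z 1 = v \<and> fst (T z) 1 = w \<and> T z \<in> G} =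
      {s \<in> seqs. \<forall>i\<in>{1..Suc n}. s i = ?t i} \<times> ?C"
    unfolding eq[symmetric] G_def T_def space_Q by auto
  then have "measure Q {z \<in> space Q. fst z 1 = v \<and> fst (T z) 1 = w \<and> T z \<in> G} =
      measure N {s \<in> seqs. \<forall>i\<in>{1..Suc n}. s i = ?t i} * measure M ?C"
    using measure_rectangle[OF cylinder_in_sets, of ?C "Suc n" ?t] C by (simp add: sets_M_vimage)
  also have "measure M ?C = measure M C"
    using C by (intro measure_act_vimage) auto
  also have "measure N {s \<in> seqs. \<forall>i\<in>{1..Suc n}. s i = ?t i} =
      \<nu> (?t (Suc n)) * (\<Prod>i\<in>{1..<Suc n}. P (?t (Suc i)) (?t i))"
    by (rule measure_cylinder) simp
  also have "(\<Prod>i\<in>{1..<Suc n}. P (?t (Suc i)) (?t i)) =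
      P (?t 2) (?t 1) * (\<Prod>i\<in>{1..<n}. P (?t (Suc (Suc i))) (?t (Suc i)))"
    using n by (subst prod.atLeast_Suc_lessThan) (simp_all add: numeral_2_eq_2 prod.shift_bounds_Suc_ivl del: prod.op_ivl_Suc)
  also have "(\<Prod>i\<in>{1..<n}. P (?t (Suc (Suc i))) (?t (Suc i))) = (\<Prod>i\<in>{1..<n}. P (t (Suc i)) (t i))"
    by (rule prod.cong) (auto simp: cons_seq_def)
  also have "\<nu> (?t (Suc n)) * (P (?t 2) (?t 1) * (\<Prod>i\<in>{1..<n}. P (t (Suc i)) (t i))) =
      P w v * (\<nu> (t n) * (\<Prod>i\<in>{1..<n}. P (t (Suc i)) (t i)))"
    using True n by (simp add: cons_seq_def)
  also have "\<nu> (t n) * (\<Prod>i\<in>{1..<n}. P (t (Suc i)) (t i)) =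
      measure N {s \<in> seqs. \<forall>i\<in>{1..n}. s i = t i}"
    using measure_cylinder[OF n] by simp
  also have "P w v * measure N {s \<in> seqs. \<forall>i\<in>{1..n}. s i = t i} * measure M C = P w v * measure Q G"
    unfolding G_def using measure_rectangle[OF cylinder_in_sets C] by simp
  finally have "measure Q {z \<in> space Q. fst z 1 = v \<and> fst (T z) 1 = w \<and> T z \<in> G} = P w v * measure Q G" .
  moreover have "{z \<in> G. fst z 1 = w} = G"
    using True n unfolding G_def by auto
  ultimately show ?thesis by simp
qed

lemma P_nonneg: "P v w \<ge> 0" and P_sum: "(\<Sum>w\<in>UNIV. P v w) = 1"
  using stochastic by (auto simp: stochastic_matrix_def)

text \<open>
  Both sides are finite measures in \<open>G\<close> that agree on the generating algebra of finitary sets, since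
  these are finite disjoint unions of the cylinders treated before.
\<close>

lemma mass_transition:
  assumes G: "G \<in> sets Q"
  shows "measure Q {z \<in> space Q. fst z 1 = v \<and> fst (T z) 1 = w \<and> T z \<in> G} = P w v * mass w G"
proof -
  define W where "W = {z \<in> space Q. fst z 1 = v \<and> fst (T z) 1 = w}"
  define Q1 where "Q1 = distr (density Q (indicator W)) Q T"
  define Q2 where "Q2 = scale_measure (ennreal (P w v)) (density Q (indicator {z \<in> space Q. fst z 1 = w}))"
  have sets12 [simp]: "sets Q1 = sets Q" "sets Q2 = sets Q"
    by (simp_all add: Q1_def Q2_def)
  have W: "W \<in> sets Q"
  proof -
    have "W = {z \<in> {z \<in> space Q. T z \<in> {z \<in> space Q. fst z 1 = w}}. fst z 1 = v}"
      unfolding W_def by auto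
    also have "\<dots> \<in> sets Q"
      by (intro sets_restrict_coordinate sets_vimage measurable_T sets.top) auto
    finally show ?thesis .
  qed
  have Q1: "emeasure Q1 E = ennreal (measure Q {z \<in> space Q. fst z 1 = v \<and> fst (T z) 1 = w \<and> T z \<in> E})"
    if E: "E \<in> sets Q" for E
  proof -
    have "emeasure Q1 E = emeasure (density Q (indicator W)) (T -` E \<inter> space Q)"
      unfolding Q1_def using measurable_T E by (subst emeasure_distr) auto
    also have "\<dots> = emeasure Q (W \<inter> (T -` E \<inter> space Q))"
      using W measurable_sets[OF measurable_T E] by (rule emeasure_restricted)
    also have "W \<inter> (T -` E \<inter> space Q) = {z \<in> space Q. fst z 1 = v \<and> fst (T z) 1 = w \<and> T z \<in> E}"
      unfolding W_def by auto
    finally show ?thesis by (simp add: Q.P.emeasure_eq_measure)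
  qed
  have Q2: "emeasure Q2 E = ennreal (P w v * mass w E)" if E: "E \<in> sets Q" for E
  proof -
    have "emeasure Q2 E = ennreal (P w v) * emeasure Q ({z \<in> space Q. fst z 1 = w} \<inter> E)"
      unfolding Q2_def using sets_restrict_coordinate[OF sets.top] E
      by (simp add: emeasure_restricted)
    also have "{z \<in> space Q. fst z 1 = w} \<inter> E = {z \<in> E. fst z 1 = w}"
      using sets.sets_into_space[OF E] by auto
    finally show ?thesis
      by (simp add: Q.P.emeasure_eq_measure mass_def ennreal_mult P_nonneg)
  qed
  have fin: "emeasure Q1 E = emeasure Q2 E" if E: "finitary n E" for n E
  proof -
    have E': "finitary (Suc n) E" using E finitary_mono by fastforce
    \<comment> \<open>Splitting along one coordinate after the other reduces the set to cylinders.\<close>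
    have "\<forall>t. emeasure Q1 {z \<in> E. \<forall>i\<in>{1..j}. fst z i = t i} = emeasure Q2 {z \<in> E. \<forall>i\<in>{1..j}. fst z i = t i}"
      if "j \<le> Suc n" for j
      using that
    proof (induction j rule: inc_induct)
      case base
      show ?case
      proof
        fix t :: "nat \<Rightarrow> 'v"
        define t' where "t' = (\<lambda>i. if i = 0 then undefined else t i)"
        define C where "C = Pair t' -` E"
        have t': "t' \<in> seqs" by (simp add: seqs_iff t'_def)
        have C: "C \<in> sets M"
          unfolding C_def using E finitary_in_sets by (intro sets_Pair1)
        have "(s, x) \<in> E \<longleftrightarrow> (t', x) \<in> E" if "s \<in> seqs" "\<forall>i\<in>{1..Suc n}. s i = t i" for s x
          using that(1) t' by (rule finitaryD[OF E']) (use that(2) in \<open>simp add: t'_def\<close>)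
        moreover have "E \<subseteq> space Q" using E finitary_in_sets sets.sets_into_space by blast
        ultimately have eq: "{z \<in> E. \<forall>i\<in>{1..Suc n}. fst z i = t i} =
            {s \<in> seqs. \<forall>i\<in>{1..Suc n}. s i = t i} \<times> C"
          unfolding C_def space_Q by auto
        have "{s \<in> seqs. \<forall>i\<in>{1..Suc n}. s i = t i} \<times> C \<in> sets Q"
          using cylinder_in_sets C by (rule pair_measureI)
        then show "emeasure Q1 {z \<in> E. \<forall>i\<in>{1..Suc n}. fst z i = t i} =
            emeasure Q2 {z \<in> E. \<forall>i\<in>{1..Suc n}. fst z i = t i}"
          unfolding eq using markov_cylinder[of "Suc n" C v w t] C by (simp add: Q1 Q2 mass_def del: One_nat_def)
      qed
    next
      case (step j)
      show ?case
      proof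
        fix t :: "nat \<Rightarrow> 'v"
        let ?E = "{z \<in> E. \<forall>i\<in>{1..j}. fst z i = t i}"
        have "?E = E \<inter> ({s \<in> seqs. \<forall>i\<in>{1..j}. s i = t i} \<times> space M)"
          using sets.sets_into_space[OF finitary_in_sets[OF E]] by (auto simp: space_Q)
        also have "\<dots> \<in> sets Q"
          by (intro sets.Int finitary_in_sets[OF E] pair_measureI cylinder_in_sets sets.top)
        finally have meas: "?E \<in> sets Q" .
        have *: "{z \<in> ?E. fst z (Suc j) = a} = {z \<in> E. \<forall>i\<in>{1..Suc j}. fst z i = (t(Suc j := a)) i}" for a
          by (auto simp: atLeastAtMostSuc_conv)
        have "emeasure Q1 {z \<in> ?E. fst z (Suc j) = a} = emeasure Q2 {z \<in> ?E. fst z (Suc j) = a}" for a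
          unfolding * using step.IH by blast
        then show "emeasure Q1 ?E = emeasure Q2 ?E"
          using emeasure_split_coordinate[OF sets12(1) meas, of "Suc j"]
            emeasure_split_coordinate[OF sets12(2) meas, of "Suc j"] by simp
      qed
    qed
    from this[of 0] show ?thesis by simp
  qed
  have "Q1 = Q2"
  proof (rule measure_eqI_generator_eq)
    show "Int_stable {B. \<exists>n. finitary n B}"
    proof (rule Int_stableI)
      fix A B assume "A \<in> {B. \<exists>n. finitary n B}" "B \<in> {B. \<exists>n. finitary n B}"
      then obtain n m where "finitary n A" "finitary m B" by blast
      then have "finitary (max n m) (A \<inter> B)"
        using finitary_Int[OF finitary_mono finitary_mono, of n A "max n m" m B] by simp
      then show "A \<inter> B \<in> {B. \<exists>n. finitary n B}" by blast
    qed
    show "{B. \<exists>n. finitary n B} \<subseteq> Pow (space Q)"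
      using finitary_in_sets sets.sets_into_space by blast
    have "finitary 0 (space Q)" by (rule finitaryI) (auto simp: space_Q)
    then show "range (\<lambda>_::nat. space Q) \<subseteq> {B. \<exists>n. finitary n B}" by blast
    show "emeasure Q1 (space Q) \<noteq> \<infinity>" by (subst Q1) auto
  qed (use fin sets_Q_eq in auto)
  then have "ennreal (measure Q {z \<in> space Q. fst z 1 = v \<and> fst (T z) 1 = w \<and> T z \<in> G}) = ennreal (P w v * mass w G)"
    using Q1[OF G] Q2[OF G] by simp
  then show ?thesis
    by (subst (asm) ennreal_inj) (auto simp: mass_def P_nonneg)
qed

lemma mass_nonneg [simp]: "mass v E \<ge> 0"
  by (simp add: mass_def)

lemma mass_mono: "E \<subseteq> G \<Longrightarrow> G \<in> sets Q \<Longrightarrow> mass v E \<le> mass v G"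
  unfolding mass_def by (intro Q.P.finite_measure_mono sets_restrict_coordinate) auto

lemma mass_Un_le:
  assumes "E \<in> sets Q" "G \<in> sets Q"
  shows "mass v (E \<union> G) \<le> mass v E + mass v G"
proof -
  have "{z \<in> E \<union> G. fst z 1 = v} = {z \<in> E. fst z 1 = v} \<union> {z \<in> G. fst z 1 = v}" by auto
  then show ?thesis
    unfolding mass_def using assms by (simp only:) (intro measure_Un_le sets_restrict_coordinate, auto)
qed

lemma measure_split_coordinate:
  assumes "E \<in> sets Q" "i \<ge> 1"
  shows "measure Q E = (\<Sum>v\<in>UNIV. measure Q {z \<in> E. fst z i = v})"
proof -
  have "ennreal (measure Q E) = ennreal (\<Sum>v\<in>UNIV. measure Q {z \<in> E. fst z i = v})"
    using emeasure_split_coordinate[OF refl assms] by (simp add: Q.P.emeasure_eq_measure)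
  then show ?thesis by (simp add: sum_nonneg)
qed

lemma measure_eq_sum_mass: "E \<in> sets Q \<Longrightarrow> measure Q E = (\<Sum>v\<in>UNIV. mass v E)"
  unfolding mass_def by (rule measure_split_coordinate) simp_all

lemma mass_slab:
  assumes "C \<in> sets M"
  shows "mass v (slab C) = \<nu> v * measure M C"
proof -
  have "{z \<in> slab C. fst z 1 = v} = {s \<in> seqs. \<forall>i\<in>{1..1}. s i = v} \<times> C" by auto
  then show ?thesis
    unfolding mass_def using measure_rectangle[OF cylinder_in_sets assms, of 1 "\<lambda>_. v"]
      measure_cylinder[of 1 "\<lambda>_. v"] by simp
qed

text \<open>
  Over \<open>[v]\<close> the map \<open>T\<close> is inverted by \<open>S v\<close>, so this is the previous lemma summed over the second
  entry \<open>w\<close> of the sequence.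
\<close>

lemma markov:
  assumes E: "E \<in> sets Q"
  shows "mass v E = (\<Sum>w\<in>UNIV. P w v * mass w {z \<in> space Q. S v z \<in> E})"
proof -
  let ?E = "{z \<in> E. fst z 1 = v}" and ?G = "{z \<in> space Q. S v z \<in> E}"
  have G: "?G \<in> sets Q" by (rule sets_vimage[OF measurable_S E])
  have "z \<in> E \<and> fst z 1 = v \<longleftrightarrow> z \<in> space Q \<and> fst z 1 = v \<and> T z \<in> ?G" for z
    using sets.sets_into_space[OF E] S_T[of z] by auto
  then have *: "{z \<in> ?E. fst z 2 = w} = {z \<in> space Q. fst z 1 = v \<and> fst (T z) 1 = w \<and> T z \<in> ?G}" for w
    by (auto simp: T_def shift_def numeral_2_eq_2)
  have "?E \<in> sets Q" using E by (rule sets_restrict_coordinate) simp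
  then have "measure Q ?E = (\<Sum>w\<in>UNIV. measure Q {z \<in> ?E. fst z 2 = w})"
    by (rule measure_split_coordinate) simp
  then show ?thesis
    unfolding * mass_transition[OF G] mass_def[of v E] .
qed

lemma sets_sym_diff: "E \<in> sets Q \<Longrightarrow> G \<in> sets Q \<Longrightarrow> sym_diff E G \<in> sets Q"
  by auto

text \<open>
  Splitting by the first two entries makes the rows of the stochastic matrix appear, whose sums
  are \<open>1\<close>.
\<close>

lemma measure_T_vimage:
  assumes E: "E \<in> sets Q"
  shows "measure Q {z \<in> space Q. T z \<in> E} = measure Q E"
proof -
  let ?E = "{z \<in> space Q. T z \<in> E}"
  have E': "?E \<in> sets Q" by (rule sets_vimage[OF measurable_T E])
  have *: "{z \<in> space Q. S v z \<in> ?E} = E" for v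
    using sets.sets_into_space[OF E] by (auto simp del: S_T)
  have "measure Q ?E = (\<Sum>v\<in>UNIV. \<Sum>w\<in>UNIV. P w v * mass w E)"
    unfolding measure_eq_sum_mass[OF E'] markov[OF E', unfolded *] ..
  also have "\<dots> = (\<Sum>w\<in>UNIV. (\<Sum>v\<in>UNIV. P w v) * mass w E)"
    by (subst sum.swap) (simp add: sum_distrib_right)
  also have "\<dots> = measure Q E"
    by (simp add: P_sum measure_eq_sum_mass[OF E])
  finally show ?thesis .
qed

lemma measure_T_funpow_vimage:
  assumes E: "E \<in> sets Q"
  shows "measure Q {z \<in> space Q. (T ^^ n) z \<in> E} = measure Q E"
proof (induction n)
  case 0
  have "{z \<in> space Q. z \<in> E} = E" using sets.sets_into_space[OF E] by auto
  then show ?case by simp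
next
  case (Suc n)
  have "{z \<in> space Q. (T ^^ Suc n) z \<in> E} = {z \<in> space Q. T z \<in> {z \<in> space Q. (T ^^ n) z \<in> E}}"
    by (auto simp: funpow_swap1)
  then show ?case
    using Suc measure_T_vimage[OF sets_vimage[OF measurable_T_funpow E, of n]] by simp
qed

section \<open>Prepending paths\<close>

definition lift :: "'v list \<Rightarrow> (nat \<Rightarrow> 'v) \<times> 'x \<Rightarrow> (nat \<Rightarrow> 'v) \<times> 'x" where
  "lift b = foldr S b"

lemma lift_simps [simp]: "lift [] z = z" "lift (v # b) z = S v (lift b z)"
  by (simp_all add: lift_def)

lemma lift_closed [simp]: "z \<in> space Q \<Longrightarrow> lift b z \<in> space Q"
  by (induction b) auto

lemma measurable_lift [measurable]: "lift b \<in> measurable Q Q"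
proof (induction b)
  case Nil
  then show ?case by simp
next
  case (Cons v b)
  then show ?case using measurable_compose[OF Cons measurable_S, of v] by simp
qed

lemma snd_lift: "z \<in> space Q \<Longrightarrow> snd (lift b z) = \<phi> (label b) (snd z)"
proof (induction b)
  case Nil
  then show ?case by (simp add: path_label_simps)
next
  case (Cons v b)
  then show ?case by (simp add: S_def path_label_simps act_mult)
qed

text \<open>
  So closeness to a slab is passed on along a path, the slab being moved by the label.
\<close>

lemma lift_vimage_slab:
  assumes "C \<in> sets M"
  shows "{z \<in> space Q. lift b z \<in> slab C} = slab {x \<in> space M. \<phi> (label b) x \<in> C}"
proof -
  have *: "z \<in> space Q \<and> lift b z \<in> slab C \<longleftrightarrow> z \<in> slab {x \<in> space M. \<phi> (label b) x \<in> C}" for z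
  proof (cases "z \<in> space Q")
    case True
    then have "fst (lift b z) \<in> seqs" by simp
    then have "lift b z \<in> slab C \<longleftrightarrow> \<phi> (label b) (snd z) \<in> C"
      using snd_lift[OF True, of b] by (metis mem_Times_iff)
    then show ?thesis using True by (auto simp: space_Q)
  qed (auto simp: space_Q)
  show ?thesis by (rule Set.set_eqI) (simp only: mem_Collect_eq *)
qed

text \<open>
  Of the mass of \<open>E\<close> over the first vertex, keep only the sequences that begin with the path: by the
  Markov property they have the product of the transition probabilities along the path times the
  mass over \<open>w\<close>, and that product is positive exactly because the path is directed.  The
  vertex \<open>w\<close> itself is not prepended; it is the first entry of the remaining sequence.
\<close>

lemma mass_lift_le:
  assumes "directed_path P (b @ [w])"
  shows "\<exists>c>0. \<forall>E\<in>sets Q. c * mass w {z \<in> space Q. lift b z \<in> E} \<le> mass (hd (b @ [w])) E"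
  using assms
proof (induction b)
  case Nil
  have "mass w {z \<in> space Q. z \<in> E} \<le> mass w E" if "E \<in> sets Q" for E
    using that by (intro mass_mono) auto
  then show ?case by (intro exI[of _ 1]) auto
next
  case (Cons v b)
  let ?u = "hd (b @ [w])"
  have "directed_path P (b @ [w])" and edge: "P ?u v > 0"
    using Cons.prems by (auto simp: directed_path_def successively_Cons edges_def)
  then obtain c where c: "c > 0"
    "\<And>E. E \<in> sets Q \<Longrightarrow> c * mass w {z \<in> space Q. lift b z \<in> E} \<le> mass ?u E"
    using Cons.IH by blast
  have "P ?u v * c * mass w {z \<in> space Q. lift (v # b) z \<in> E} \<le> mass v E" if E: "E \<in> sets Q" for E
  proof -
    let ?G = "{z \<in> space Q. S v z \<in> E}"
    have G: "?G \<in> sets Q" by (rule sets_vimage[OF measurable_S E])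
    have "{z \<in> space Q. lift (v # b) z \<in> E} = {z \<in> space Q. lift b z \<in> ?G}" by auto
    then have "P ?u v * c * mass w {z \<in> space Q. lift (v # b) z \<in> E} \<le> P ?u v * mass ?u ?G"
      using c(2)[OF G] edge by (simp add: mult.assoc mult_left_mono)
    also have "\<dots> \<le> (\<Sum>u\<in>UNIV. P u v * mass u ?G)"
      using P_nonneg by (intro member_le_sum) auto
    also have "\<dots> = mass v E" using markov[OF E] by simp
    finally show ?thesis .
  qed
  moreover have "P ?u v * c > 0" using edge c(1) by simp
  ultimately show ?case by (intro exI[of _ "P ?u v * c"]) simp
qed

text \<open>
  A pseudometric on sets, seen from the cylinder \<open>[v]\<close>.
\<close>

definition gap :: "'v \<Rightarrow> ((nat \<Rightarrow> 'v) \<times> 'x) set \<Rightarrow> ((nat \<Rightarrow> 'v) \<times> 'x) set \<Rightarrow> real" where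
  "gap v E G = mass v (sym_diff E G)"

lemma gap_commute: "gap v E G = gap v G E"
  by (simp add: gap_def Un_commute)

lemma gap_triangle:
  assumes "E \<in> sets Q" "G \<in> sets Q" "H \<in> sets Q"
  shows "gap v E H \<le> gap v E G + gap v G H"
proof -
  have "gap v E H \<le> mass v (sym_diff E G \<union> sym_diff G H)"
    unfolding gap_def using assms by (intro mass_mono) auto
  also have "\<dots> \<le> gap v E G + gap v G H"
    unfolding gap_def using assms by (intro mass_Un_le) auto
  finally show ?thesis .
qed

lemma gap_slab:
  assumes "C \<in> sets M" "D \<in> sets M"
  shows "gap v (slab C) (slab D) = \<nu> v * measure M (sym_diff C D)"
proof -
  have "sym_diff (slab C) (slab D) = slab (sym_diff C D)" by auto
  then show ?thesis
    unfolding gap_def using mass_slab[of "sym_diff C D" v] assms by simp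
qed

lemma gap_lift_le:
  assumes "directed_path P (b @ [w])"
  shows "\<exists>c>0. \<forall>E\<in>sets Q. \<forall>G\<in>sets Q.
    gap w {z \<in> space Q. lift b z \<in> E} {z \<in> space Q. lift b z \<in> G} \<le> c * gap (hd (b @ [w])) E G"
proof -
  obtain c where c: "c > 0"
    "\<And>E. E \<in> sets Q \<Longrightarrow> c * mass w {z \<in> space Q. lift b z \<in> E} \<le> mass (hd (b @ [w])) E"
    using mass_lift_le[OF assms] by blast
  have "gap w {z \<in> space Q. lift b z \<in> E} {z \<in> space Q. lift b z \<in> G} \<le> 1 / c * gap (hd (b @ [w])) E G"
    if "E \<in> sets Q" "G \<in> sets Q" for E G
  proof -
    have "sym_diff {z \<in> space Q. lift b z \<in> E} {z \<in> space Q. lift b z \<in> G} =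
        {z \<in> space Q. lift b z \<in> sym_diff E G}" by auto
    then show ?thesis
      unfolding gap_def using c(1) c(2)[OF sets_sym_diff[OF that]] by (simp add: field_simps)
  qed
  then show ?thesis using c(1) by (intro exI[of _ "1 / c"]) auto
qed

section \<open>Tail sets are nearly independent of the sequence\<close>

text \<open>
  Forgetting the first \<open>n\<close> entries turns a finitary approximation of \<open>T\<^sup>-\<^sup>n E\<close> into an approximation
  of \<open>E\<close> by slabs.  One entry is forgotten at a time: conditioned on the second entry \<open>w\<close>, the first
  entry \<open>v\<close> is chosen with the probabilities \<open>P w v\<close>, while the set that is approximated does not
  depend on it, so some \<open>v\<close> gives an approximation no worse than the average.  The approximating sets
  are allowed to depend on the first vertex so that the induction goes through.
\<close>

lemma slabs_from_finitary:
  assumes E: "E \<in> sets Q" and "\<And>v. finitary n (B v)"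
  shows "\<exists>C. (\<forall>v. C v \<in> sets M) \<and>
    (\<Sum>v\<in>UNIV. gap v E (slab (C v))) \<le> (\<Sum>v\<in>UNIV. gap v {z \<in> space Q. (T ^^ n) z \<in> E} (B v))"
  using assms(2)
proof (induction n arbitrary: B)
  case 0
  have "\<forall>v. \<exists>C. C \<in> sets M \<and> B v = slab C"
    using finitary_0_imp_slab[OF 0] by blast
  then obtain C where C: "\<And>v. C v \<in> sets M" "\<And>v. B v = slab (C v)" by metis
  have "{z \<in> space Q. (T ^^ 0) z \<in> E} = E"
    using sets.sets_into_space[OF E] by auto
  then show ?case using C by (intro exI[of _ C]) simp
next
  case (Suc n)
  let ?E = "\<lambda>n. {z \<in> space Q. (T ^^ n) z \<in> E}"
  let ?B = "\<lambda>v. {z \<in> space Q. S v z \<in> B v}"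
  have E': "?E m \<in> sets Q" for m by (rule sets_vimage[OF measurable_T_funpow E])
  have step: "gap v (?E (Suc n)) (B v) = (\<Sum>w\<in>UNIV. P w v * gap w (?E n) (?B v))" for v
  proof -
    have "{z \<in> space Q. S v z \<in> sym_diff (?E (Suc n)) (B v)} = sym_diff (?E n) (?B v)"
      by (auto simp: funpow_Suc_right simp del: funpow.simps)
    then show ?thesis
      unfolding gap_def markov[OF sets_sym_diff[OF E' finitary_in_sets[OF Suc.prems]]] by (simp only:)
  qed
  \<comment> \<open>For each state, the best of its predecessors does at least as well as their average.\<close>
  have "\<forall>w. \<exists>v. gap w (?E n) (?B v) \<le> (\<Sum>v\<in>UNIV. P w v * gap w (?E n) (?B v))"
    by (intro allI exists_le_average P_nonneg P_sum)
  from choice[OF this]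
  obtain f where f: "\<And>w. gap w (?E n) (?B (f w)) \<le> (\<Sum>v\<in>UNIV. P w v * gap w (?E n) (?B v))"
    by blast
  have "\<And>w. finitary n (?B (f w))"
    using finitary_vimage_S[OF Suc.prems] .
  then obtain C where C: "\<forall>v. C v \<in> sets M"
    "(\<Sum>v\<in>UNIV. gap v E (slab (C v))) \<le> (\<Sum>w\<in>UNIV. gap w (?E n) (?B (f w)))"
    using Suc.IH[of "\<lambda>w. ?B (f w)"] by blast
  note C(2)
  also have "(\<Sum>w\<in>UNIV. gap w (?E n) (?B (f w))) \<le>
      (\<Sum>w\<in>UNIV. \<Sum>v\<in>UNIV. P w v * gap w (?E n) (?B v))"
    by (intro sum_mono f)
  also have "\<dots> = (\<Sum>v\<in>UNIV. gap v (?E (Suc n)) (B v))"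
    unfolding step by (rule sum.swap)
  finally show ?case using C(1) by blast
qed

text \<open>
  The images of a tail set under the powers of \<open>T\<close>: the set \<open>A n\<close> is what remains of \<open>A 0\<close> when
  the first \<open>n\<close> entries are forgotten.
\<close>

definition descending :: "(nat \<Rightarrow> ((nat \<Rightarrow> 'v) \<times> 'x) set) \<Rightarrow> bool" where
  "descending A \<longleftrightarrow> (\<forall>n. A n \<in> sets Q) \<and> (\<forall>n. \<forall>z\<in>space Q. z \<in> A n \<longleftrightarrow> T z \<in> A (Suc n))"

lemma descending_in_sets: "descending A \<Longrightarrow> A n \<in> sets Q"
  by (simp add: descending_def)

lemma descending_T: "descending A \<Longrightarrow> z \<in> space Q \<Longrightarrow> T z \<in> A (Suc n) \<longleftrightarrow> z \<in> A n"
  by (simp add: descending_def)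

lemma descending_T_funpow:
  assumes "descending A" "z \<in> space Q"
  shows "(T ^^ m) z \<in> A (n + m) \<longleftrightarrow> z \<in> A n"
proof (induction m)
  case (Suc m)
  have "(T ^^ Suc m) z \<in> A (n + Suc m) \<longleftrightarrow> (T ^^ m) z \<in> A (n + m)"
    using descending_T[OF assms(1) T_funpow_closed[OF assms(2)], of m] by simp
  with Suc show ?case by simp
qed simp

text \<open>
  Every branch \<open>S v\<close> is undone by \<open>T\<close>, whatever the vertex \<open>v\<close>, so only the length counts.
\<close>

lemma descending_lift:
  assumes "descending A"
  shows "{z \<in> space Q. lift b z \<in> A n} = A (n + length b)"
proof -
  have "lift b z \<in> A n \<longleftrightarrow> z \<in> A (n + length b)" if "z \<in> space Q" for z
  proof (induction b arbitrary: n)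
    case (Cons v b)
    have "S v (lift b z) \<in> A n \<longleftrightarrow> lift b z \<in> A (Suc n)"
      using descending_T[OF assms, of "S v (lift b z)" n] that by simp
    with Cons show ?case by simp
  qed simp
  then show ?thesis
    using sets.sets_into_space[OF descending_in_sets[OF assms]] by blast
qed

text \<open>
  A 0-1 law: \<open>A 0\<close> is approximated by a set that depends on finitely many entries, and \<open>A n\<close>
  has forgotten these entries once \<open>n\<close> is large.
\<close>

lemma descending_near_slab:
  assumes A: "descending A" and e: "e > 0"
  shows "\<exists>n0. \<forall>n\<ge>n0. \<forall>v. \<exists>C\<in>sets M. gap v (A n) (slab C) \<le> e"
proof -
  obtain n0 B where B: "finitary n0 B" "measure Q (sym_diff (A 0) B) < e"
    using finitary_approximation[OF descending_in_sets[OF A] e] by blast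
  have "\<exists>C\<in>sets M. gap v (A n) (slab C) \<le> e" if n: "n \<ge> n0" for n v
  proof -
    have "{z \<in> space Q. (T ^^ n) z \<in> A n} = A 0"
      using descending_T_funpow[OF A, where n = 0 and m = n]
        sets.sets_into_space[OF descending_in_sets[OF A]] by auto
    then obtain C where C: "\<forall>v. C v \<in> sets M"
      "(\<Sum>v\<in>UNIV. gap v (A n) (slab (C v))) \<le> (\<Sum>v\<in>UNIV. gap v (A 0) B)"
      using slabs_from_finitary[OF descending_in_sets[OF A], of n "\<lambda>_. B" n]
        finitary_mono[OF B(1) n] by auto
    have "gap v (A n) (slab (C v)) \<le> (\<Sum>v\<in>UNIV. gap v (A n) (slab (C v)))"
      by (intro member_le_sum) (auto simp: gap_def)
    also note C(2)
    also have "(\<Sum>v\<in>UNIV. gap v (A 0) B) = measure Q (sym_diff (A 0) B)"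
      unfolding gap_def
      using descending_in_sets[OF A] finitary_in_sets[OF B(1)] by (subst measure_eq_sum_mass) auto
    finally show ?thesis using B(2) C(1) by (intro bexI[of _ "C v"]) auto
  qed
  then show ?thesis by blast
qed

section \<open>The good subgraph and irreducibility\<close>

text \<open>
  One slab over \<open>[u]\<close> is transported to \<open>[w]\<close> along three paths.  Two of them have the same length,
  so their slabs approximate the same set, and the third slab is compared with the first
  by the group element that carries the first to the second.
\<close>

lemma gap_good_vertex:
  assumes A: "descending A" and e: "e > 0"
    and len: "length p = k" "length q = k" "length q' = k"
    and paths: "directed_path P (u # p @ [w])" "directed_path P (u # q @ [w])"
      "directed_path P (u # p @ q' @ p @ [w])"
    and label: "label q' = inv\<^bsub>F\<^esub> (label q)"
  shows "\<exists>n0. \<forall>n\<ge>n0. gap w (A n) (A (n + 2 * k)) \<le> e"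
proof -
  let ?b1 = "u # p" and ?b2 = "u # q" and ?b3 = "u # p @ q' @ p"
  have "\<forall>b\<in>{?b1, ?b2, ?b3}. \<exists>c. c > 0 \<and> (\<forall>E\<in>sets Q. \<forall>G\<in>sets Q.
      gap w {z \<in> space Q. lift b z \<in> E} {z \<in> space Q. lift b z \<in> G} \<le> c * gap u E G)"
  proof
    fix b assume that: "b \<in> {?b1, ?b2, ?b3}"
    have "directed_path P (b @ [w])" and "hd (b @ [w]) = u" using paths that by auto
    then show "\<exists>c. c > 0 \<and> (\<forall>E\<in>sets Q. \<forall>G\<in>sets Q.
      gap w {z \<in> space Q. lift b z \<in> E} {z \<in> space Q. lift b z \<in> G} \<le> c * gap u E G)"
      using gap_lift_le[of b w] by simp
  qed
  from bchoice[OF this] obtain c where c: "\<forall>b\<in>{?b1, ?b2, ?b3}. c b > 0 \<and> (\<forall>E\<in>sets Q. \<forall>G\<in>sets Q.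
      gap w {z \<in> space Q. lift b z \<in> E} {z \<in> space Q. lift b z \<in> G} \<le> c b * gap u E G)" ..
  have c_pos: "c b > 0" if "b \<in> {?b1, ?b2, ?b3}" for b
    using bspec[OF c that] by (rule conjunct1)
  have c_le: "gap w {z \<in> space Q. lift b z \<in> E} {z \<in> space Q. lift b z \<in> G} \<le> c b * gap u E G"
    if "b \<in> {?b1, ?b2, ?b3}" "E \<in> sets Q" "G \<in> sets Q" for b E G
    using bspec[OF bspec[OF conjunct2[OF bspec[OF c that(1)]] that(2)] that(3)] .
  \<comment> \<open>\<open>K\<close> counts, with weights, the errors that the triangle inequalities below add up.\<close>
  define K where "K = 2 * c ?b1 + c ?b2 + c ?b3"
  have K: "K > 0" using c_pos unfolding K_def by (intro add_pos_pos mult_pos_pos) auto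
  define d where "d = e / K"
  have d: "d > 0" using e K by (simp add: d_def)
  obtain n0 where n0: "\<And>n. n \<ge> n0 \<Longrightarrow> \<exists>C\<in>sets M. gap u (A n) (slab C) \<le> d"
    using descending_near_slab[OF A d] by auto
  have "gap w (A (n + Suc k)) (A (n + Suc k + 2 * k)) \<le> e" if n: "n \<ge> n0" for n
  proof -
    obtain C where C: "C \<in> sets M" "gap u (A n) (slab C) \<le> d" using n0[OF n] by blast
    define D where "D b = {x \<in> space M. \<phi> (label b) x \<in> C}" for b
    have D: "D b \<in> sets M" for b unfolding D_def by (rule sets_M_vimage) (use C in auto)
    have near: "gap w (A (n + length b)) (slab (D b)) \<le> c b * d" if b: "b \<in> {?b1, ?b2, ?b3}" for b
    proof -
      have "gap w (A (n + length b)) (slab (D b)) \<le> c b * gap u (A n) (slab C)"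
        using c_le[OF b descending_in_sets[OF A] slab_in_sets[OF C(1)], of n]
        unfolding descending_lift[OF A] lift_vimage_slab[OF C(1)] D_def .
      also have "\<dots> \<le> c b * d"
        using C(2) c_pos[OF b] by (intro mult_left_mono) auto
      finally show ?thesis .
    qed
    have l: "n + length ?b1 = n + Suc k" "n + length ?b2 = n + Suc k"
      "n + length ?b3 = n + Suc k + 2 * k"
      using len by simp_all
    have n1: "gap w (A (n + Suc k)) (slab (D ?b1)) \<le> c ?b1 * d"
      and n2: "gap w (A (n + Suc k)) (slab (D ?b2)) \<le> c ?b2 * d"
      and n3: "gap w (A (n + Suc k + 2 * k)) (slab (D ?b3)) \<le> c ?b3 * d"
      using near[of ?b1] near[of ?b2] near[of ?b3] unfolding l by blast+
    \<comment> \<open>The label of \<open>q\<close> inverse times that of \<open>p\<close> carries the pair \<open>D ?b1\<close>, \<open>D ?b3\<close> to \<open>D ?b2\<close>, \<open>D ?b1\<close>.\<close>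
    let ?g = "inv\<^bsub>F\<^esub> (label q) \<otimes>\<^bsub>F\<^esub> label p"
    have "x \<in> D ?b1 \<longleftrightarrow> \<phi> ?g x \<in> D ?b2" "x \<in> D ?b3 \<longleftrightarrow> \<phi> ?g x \<in> D ?b1" if "x \<in> space M" for x
      using that unfolding D_def
      by (simp_all add: path_label_simps label_append label act_mult)
    then have "sym_diff (D ?b1) (D ?b3) = {x \<in> space M. \<phi> ?g x \<in> sym_diff (D ?b2) (D ?b1)}"
      unfolding D_def by blast
    then have "measure M (sym_diff (D ?b1) (D ?b3)) = measure M (sym_diff (D ?b2) (D ?b1))"
      using measure_act_vimage[of ?g "sym_diff (D ?b2) (D ?b1)"] D by simp
    then have "gap w (slab (D ?b1)) (slab (D ?b3)) = gap w (slab (D ?b2)) (slab (D ?b1))"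
      using D by (simp add: gap_slab)
    also have "\<dots> \<le> gap w (slab (D ?b2)) (A (n + Suc k)) + gap w (A (n + Suc k)) (slab (D ?b1))"
      by (intro gap_triangle slab_in_sets D descending_in_sets[OF A])
    also have "\<dots> \<le> c ?b2 * d + c ?b1 * d"
      using n1 n2 by (simp add: gap_commute[of w "slab (D ?b2)"])
    finally have n13: "gap w (slab (D ?b1)) (slab (D ?b3)) \<le> c ?b2 * d + c ?b1 * d" .
    have "gap w (A (n + Suc k)) (A (n + Suc k + 2 * k)) \<le>
        gap w (A (n + Suc k)) (slab (D ?b1)) + gap w (slab (D ?b1)) (A (n + Suc k + 2 * k))"
      by (intro gap_triangle slab_in_sets D descending_in_sets[OF A])
    also have "gap w (slab (D ?b1)) (A (n + Suc k + 2 * k)) \<le>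
        gap w (slab (D ?b1)) (slab (D ?b3)) + gap w (slab (D ?b3)) (A (n + Suc k + 2 * k))"
      by (intro gap_triangle slab_in_sets D descending_in_sets[OF A])
    finally have "gap w (A (n + Suc k)) (A (n + Suc k + 2 * k)) \<le>
        c ?b1 * d + (c ?b2 * d + c ?b1 * d) + c ?b3 * d"
      using n1 n13 n3 unfolding gap_commute[of w "slab (D ?b3)"] by linarith
    also have "\<dots> = K * d" unfolding K_def by (simp add: algebra_simps)
    also have "\<dots> = e" using K by (simp add: d_def)
    finally show ?thesis .
  qed
  then have "gap w (A n) (A (n + 2 * k)) \<le> e" if "n \<ge> n0 + Suc k" for n
    using that by (metis add_leD1 le_add_diff_inverse2 le_diff_conv2 add_leD2)
  then show ?thesis by blast
qed

text \<open>
  Over \<open>[v]\<close> both sets are close to slabs, and the measure of the difference of two slabs can be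
  read off over any vertex, in particular after transport along a path to \<open>w\<close>.
\<close>

lemma gap_every_vertex:
  assumes A: "descending A" and e: "e > 0"
    and reach: "(v, w) \<in> (edges P)\<^sup>*"
    and w: "\<And>e. e > 0 \<Longrightarrow> \<exists>n0. \<forall>n\<ge>n0. gap w (A n) (A (n + m)) \<le> e"
  shows "\<exists>n0. \<forall>n\<ge>n0. gap v (A n) (A (n + m)) \<le> e"
proof -
  obtain b where "directed_path P (b @ [w])" "hd (b @ [w]) = v"
    using path_of_rtrancl[OF reach] by blast
  then obtain c where c: "c > 0"
    "\<And>E G. E \<in> sets Q \<Longrightarrow> G \<in> sets Q \<Longrightarrow>
      gap w {z \<in> space Q. lift b z \<in> E} {z \<in> space Q. lift b z \<in> G} \<le> c * gap v E G"
    using gap_lift_le[of b w] by blast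
  define r where "r = \<nu> v / \<nu> w"
  have r: "r > 0" using \<nu>_pos by (simp add: r_def)
  \<comment> \<open>\<open>K\<close> counts, with weights, the errors that the triangle inequalities below add up.\<close>
  define K where "K = 2 + r * (2 * c + 1)"
  have K: "K > 0" unfolding K_def using r c(1) by (intro add_pos_pos mult_pos_pos) auto
  define d where "d = e / K"
  have d: "d > 0" using e K by (simp add: d_def)
  obtain n1 where n1: "\<And>n. n \<ge> n1 \<Longrightarrow> \<exists>C\<in>sets M. gap v (A n) (slab C) \<le> d"
    using descending_near_slab[OF A d] by auto
  obtain n2 where n2: "\<And>n. n \<ge> n2 \<Longrightarrow> gap w (A n) (A (n + m)) \<le> d"
    using w[OF d] by auto
  have "gap v (A n) (A (n + m)) \<le> e" if n: "n \<ge> max n1 n2" for n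
  proof -
    obtain C where C: "C \<in> sets M" "gap v (A n) (slab C) \<le> d" using n1[of n] n by auto
    obtain C' where C': "C' \<in> sets M" "gap v (A (n + m)) (slab C') \<le> d" using n1[of "n + m"] n by auto
    define D where "D C = {x \<in> space M. \<phi> (label b) x \<in> C}" for C
    have D: "D B \<in> sets M" if "B \<in> sets M" for B unfolding D_def by (rule sets_M_vimage) (use that in auto)
    have near: "gap w (A (j + length b)) (slab (D B)) \<le> c * d" if B: "B \<in> sets M" "gap v (A j) (slab B) \<le> d" for B j
    proof -
      have "gap w (A (j + length b)) (slab (D B)) \<le> c * gap v (A j) (slab B)"
        using c(2)[OF descending_in_sets[OF A] slab_in_sets[OF B(1)], of j]
        unfolding descending_lift[OF A] lift_vimage_slab[OF B(1)] D_def .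
      also have "\<dots> \<le> c * d" using B(2) c(1) by (intro mult_left_mono) auto
      finally show ?thesis .
    qed
    let ?l = "n + length b"
    have m: "gap w (A ?l) (A (?l + m)) \<le> d" using n2[of ?l] n by auto
    have "gap w (slab (D C)) (slab (D C')) \<le> gap w (slab (D C)) (A ?l) + gap w (A ?l) (slab (D C'))"
      by (intro gap_triangle slab_in_sets D C C' descending_in_sets[OF A])
    also have "gap w (A ?l) (slab (D C')) \<le> gap w (A ?l) (A (?l + m)) + gap w (A (?l + m)) (slab (D C'))"
      by (intro gap_triangle slab_in_sets D C C' descending_in_sets[OF A])
    finally have DC: "gap w (slab (D C)) (slab (D C')) \<le> (2 * c + 1) * d"
      using near[OF C] near[OF C'] m unfolding gap_commute[of w "slab (D C)"]
      by (simp add: algebra_simps)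
    have "sym_diff (D C) (D C') = {x \<in> space M. \<phi> (label b) x \<in> sym_diff C C'}"
      unfolding D_def by blast
    then have "measure M (sym_diff (D C) (D C')) = measure M (sym_diff C C')"
      using measure_act_vimage[of "label b" "sym_diff C C'"] C(1) C'(1) by simp
    then have "gap v (slab C) (slab C') = r * gap w (slab (D C)) (slab (D C'))"
      using C(1) C'(1) D \<nu>_pos[of w] by (simp add: gap_slab r_def)
    also have "\<dots> \<le> r * ((2 * c + 1) * d)" using DC r by (intro mult_left_mono) auto
    finally have CC: "gap v (slab C) (slab C') \<le> r * ((2 * c + 1) * d)" .
    have "gap v (A n) (A (n + m)) \<le> gap v (A n) (slab C) + gap v (slab C) (A (n + m))"
      by (intro gap_triangle slab_in_sets C C' descending_in_sets[OF A])
    also have "gap v (slab C) (A (n + m)) \<le> gap v (slab C) (slab C') + gap v (slab C') (A (n + m))"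
      by (intro gap_triangle slab_in_sets C C' descending_in_sets[OF A])
    finally have "gap v (A n) (A (n + m)) \<le> d + r * ((2 * c + 1) * d) + d"
      using C(2) C'(2) CC unfolding gap_commute[of v "slab C'"] by linarith
    also have "\<dots> = K * d" unfolding K_def by (simp add: algebra_simps)
    also have "\<dots> = e" using K by (simp add: d_def)
    finally show ?thesis .
  qed
  then show ?thesis by blast
qed

text \<open>
  The set of points where invariance fails is the preimage of the difference of \<open>A n\<close> and
  \<open>A (n + m)\<close> under a power of \<open>T\<close>, for every \<open>n\<close>; hence its measure is below every bound.
\<close>

lemma AE_invariant:
  assumes A: "descending A"
    and small: "\<And>v e. e > 0 \<Longrightarrow> \<exists>n0. \<forall>n\<ge>n0. gap v (A n) (A (n + m)) \<le> e"
  shows "AE z in Q. z \<in> A 0 \<longleftrightarrow> (T ^^ m) z \<in> A 0"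
proof -
  let ?D = "{z \<in> space Q. \<not> (z \<in> A 0 \<longleftrightarrow> (T ^^ m) z \<in> A 0)}"
  have D: "?D = {z \<in> space Q. (T ^^ (n + m)) z \<in> sym_diff (A n) (A (n + m))}" for n
  proof -
    have "(T ^^ (n + m)) z \<in> A (n + m) \<longleftrightarrow> z \<in> A 0" "(T ^^ (n + m)) z \<in> A n \<longleftrightarrow> (T ^^ m) z \<in> A 0"
      if "z \<in> space Q" for z
      using descending_T_funpow[OF A that, of "n + m" 0]
        descending_T_funpow[OF A T_funpow_closed[OF that, of m], of n 0]
      by (simp_all add: T_funpow_add)
    then show ?thesis by blast
  qed
  have meas: "sym_diff (A n) (A (n + m)) \<in> sets Q" for n
    by (intro sets_sym_diff descending_in_sets[OF A])
  have Dm: "?D \<in> sets Q" unfolding D[of 0] by (intro sets_vimage measurable_T_funpow meas)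
  have "measure Q ?D \<le> 0 + e" if "e > 0" for e
  proof -
    let ?d = "e / real CARD('v)"
    have d: "?d > 0" using that by (simp add: card_gt_0_iff)
    from small[OF d] have "\<forall>v. \<exists>n0. \<forall>n\<ge>n0. gap v (A n) (A (n + m)) \<le> ?d" by blast
    from choice[OF this] obtain n0 where n0: "\<And>v n. n \<ge> n0 v \<Longrightarrow> gap v (A n) (A (n + m)) \<le> ?d"
      by blast
    define n where "n = Max (range n0)"
    have n: "n \<ge> n0 v" for v unfolding n_def by simp
    have "measure Q ?D = measure Q (sym_diff (A n) (A (n + m)))"
      unfolding D[of n] by (rule measure_T_funpow_vimage[OF meas])
    also have "\<dots> = (\<Sum>v\<in>UNIV. gap v (A n) (A (n + m)))"
      unfolding gap_def by (rule measure_eq_sum_mass[OF meas])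
    also have "\<dots> \<le> (\<Sum>v\<in>(UNIV :: 'v set). ?d)"
      using n0 n by (intro sum_mono) auto
    also have "\<dots> = e" by simp
    finally show ?thesis by simp
  qed
  then have "measure Q ?D \<le> 0" by (rule field_le_epsilon)
  then have "emeasure Q ?D = 0"
    by (simp add: Q.P.emeasure_eq_measure order_antisym[OF _ measure_nonneg])
  then show ?thesis
    using Dm by (intro AE_I[of _ _ ?D]) auto
qed

section \<open>Comparing the two sigma-algebras\<close>

text \<open>
  The image of a synchronously saturated set under \<open>T\<^sup>n\<close> is found by prepending \<open>n\<close> copies of an
  arbitrary vertex, since all points with the same image under \<open>T\<^sup>n\<close> are equivalent.  Writing it as a
  preimage makes it measurable.
\<close>

lemma F_sync_descending:
  assumes A: "A \<in> F_sync F L N M \<phi>"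
  shows "\<exists>A'. descending A' \<and> A' 0 = A"
proof -
  define v0 :: 'v where "v0 = undefined"
  define A' where "A' n = {z \<in> space Q. lift (replicate n v0) z \<in> A}" for n
  have AQ: "A \<in> sets Q" using A by (simp add: F_sync_iff)
  have T_lift: "(T ^^ n) (lift (replicate n v0) z) = z" if "z \<in> space Q" for n z
    using that by (induction n) (auto simp: funpow_Suc_right simp del: funpow.simps)
  have "z \<in> A' n \<longleftrightarrow> T z \<in> A' (Suc n)" if z: "z \<in> space Q" for z n
  proof -
    let ?y = "lift (replicate n v0) z" and ?y' = "lift (replicate (Suc n) v0) (T z)"
    have "(T ^^ Suc n) ?y = T z" using T_lift[OF z, of n] by simp
    moreover have "(T ^^ Suc n) ?y' = T z" using T_lift[OF T_closed[OF z], of "Suc n"] .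
    moreover have "?y \<in> space Q" "?y' \<in> space Q" using z by (simp_all del: replicate.simps lift_simps)
    ultimately have "?y \<in> A \<longleftrightarrow> ?y' \<in> A"
      using A unfolding F_sync_iff by metis
    then show ?thesis unfolding A'_def using z by simp
  qed
  moreover have "A' n \<in> sets Q" for n
    unfolding A'_def by (rule sets_vimage[OF measurable_lift AQ])
  moreover have "A' 0 = A"
    using sets.sets_into_space[OF AQ] by (auto simp: A'_def)
  ultimately show ?thesis by (intro exI[of _ A']) (simp add: descending_def)
qed

lemma F_tail_subset_F_sync: "F_tail F L N M \<phi> m \<subseteq> F_sync F L N M \<phi>"
  unfolding F_tail_iff F_sync_iff subset_iff by (metis diff_self dvd_0_right)

text \<open>
  The representative consists of the points that return to \<open>A\<close> infinitely often under \<open>T\<^sup>m\<close>, a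
  property that does not change when finitely many steps are dropped or added in multiples of \<open>m\<close>.
\<close>

lemma F_tail_representative:
  assumes A: "A \<in> F_sync F L N M \<phi>" and m: "m \<ge> 1"
    and inv: "AE z in Q. z \<in> A \<longleftrightarrow> (T ^^ m) z \<in> A"
  shows "\<exists>B\<in>F_tail F L N M \<phi> m. sym_diff B A \<in> null_sets Q"
proof -
  have AQ: "A \<in> sets Q" using A by (simp add: F_sync_iff)
  define B where "B = {z \<in> space Q. \<forall>i. \<exists>j\<ge>i. (T ^^ (m * j)) z \<in> A}"
  have "B = (\<Inter>i. \<Union>j\<in>{i..}. {z \<in> space Q. (T ^^ (m * j)) z \<in> A})"
    unfolding B_def by auto
  also have "\<dots> \<in> sets Q"
    using sets_vimage[OF measurable_T_funpow AQ] by (intro sets.countable_INT sets.countable_UN) auto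
  finally have BQ: "B \<in> sets Q" .
  have "z' \<in> B" if z: "z \<in> space Q" "z' \<in> space Q" and d: "int m dvd int b - int a"
    and eq: "(T ^^ a) z = (T ^^ b) z'" and zB: "z \<in> B" for z z' a b
  proof -
    have "\<exists>j\<ge>i. (T ^^ (m * j)) z' \<in> A" for i
    proof -
      obtain r where r: "int b - int a = int m * r" using d by blast
      \<comment> \<open>A late visit of \<open>z\<close>: past \<open>a\<close>, and past \<open>i\<close> even after the change by \<open>r\<close> steps.\<close>
      obtain j where j: "j \<ge> a + i + nat \<bar>r\<bar>" "(T ^^ (m * j)) z \<in> A"
        using zB unfolding B_def by blast
      define j' where "j' = nat (int j + r)"
      have j': "int j' = int j + r" "j' \<ge> i" using j(1) by (auto simp: j'_def)
      have "a \<le> m * j" using j(1) m by (metis add_leD1 le_trans mult_le_mono1 mult_1)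
      then have mj: "m * j = (m * j - a) + a" by simp
      have "int (m * j') = int (m * j) + (int b - int a)"
        unfolding r by (simp add: j'(1) algebra_simps)
      then have mj': "m * j' = (m * j - a) + b" using \<open>a \<le> m * j\<close> by linarith
      have "(T ^^ (m * j')) z' = (T ^^ (m * j)) z"
        using T_funpow_add[of "m * j - a" a z] T_funpow_add[of "m * j - a" b z'] eq
        unfolding mj[symmetric] mj'[symmetric] by simp
      then show ?thesis using j j' by auto
    qed
    then show ?thesis using z by (simp add: B_def)
  qed
  then have "B \<in> F_tail F L N M \<phi> m"
    using BQ unfolding F_tail_iff by blast
  moreover have "sym_diff B A \<in> null_sets Q"
  proof -
    have *: "AE z in Q. (T ^^ n) z \<in> A \<longleftrightarrow> (T ^^ m) ((T ^^ n) z) \<in> A" for n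
    proof -
      let ?D = "{z \<in> space Q. \<not> (z \<in> A \<longleftrightarrow> (T ^^ m) z \<in> A)}"
      have "?D = sym_diff A {z \<in> space Q. (T ^^ m) z \<in> A}"
        using sets.sets_into_space[OF AQ] by auto
      also have "\<dots> \<in> sets Q" by (intro sets_sym_diff sets_vimage measurable_T_funpow AQ)
      finally have D: "?D \<in> sets Q" .
      have "emeasure Q ?D = 0" using inv D by (simp add: AE_iff_measurable[OF D refl])
      then have "emeasure Q {z \<in> space Q. (T ^^ n) z \<in> ?D} = 0"
        using measure_T_funpow_vimage[OF D, of n] by (simp add: Q.P.emeasure_eq_measure)
      moreover have "{z \<in> space Q. (T ^^ n) z \<in> ?D} \<in> sets Q"
        by (rule sets_vimage[OF measurable_T_funpow D])
      ultimately show ?thesis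
        by (intro AE_I[of _ _ "{z \<in> space Q. (T ^^ n) z \<in> ?D}"]) auto
    qed
    have "AE z in Q. \<forall>j. z \<in> A \<longleftrightarrow> (T ^^ (m * j)) z \<in> A"
    proof -
      have "AE z in Q. \<forall>j. (T ^^ (m * j)) z \<in> A \<longleftrightarrow> (T ^^ m) ((T ^^ (m * j)) z) \<in> A"
        using * by (simp add: AE_all_countable)
      then show ?thesis
      proof eventually_elim
        case (elim z)
        show ?case
        proof
          fix j show "z \<in> A \<longleftrightarrow> (T ^^ (m * j)) z \<in> A"
            using elim by (induction j) (simp_all add: T_funpow_add)
        qed
      qed
    qed
    then have "AE z in Q. z \<notin> sym_diff B A"
    proof (rule AE_mp[OF _ AE_I2], intro impI)
      fix z assume "z \<in> space Q" "\<forall>j. z \<in> A \<longleftrightarrow> (T ^^ (m * j)) z \<in> A"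
      then show "z \<notin> sym_diff B A" unfolding B_def by auto
    qed
    then show ?thesis
      using BQ AQ by (simp add: AE_iff_null_sets)
  qed
  ultimately show ?thesis by blast
qed

end

theorem theorem1p6:
  fixes F :: "('g, 'b) monoid_scheme"
    and L :: "'v::finite \<Rightarrow> 'g"
    and P :: "'v \<Rightarrow> 'v \<Rightarrow> real"
    and \<nu> :: "'v \<Rightarrow> real"
    and N :: "(nat \<Rightarrow> 'v) measure"
    and M :: "'x measure"
    and \<phi> :: "'g \<Rightarrow> 'x \<Rightarrow> 'x"
    and k :: nat
  assumes "free_group F" and "finitely_generated_group F"
    and "\<And>v. L v \<in> carrier F"
    and "stochastic_matrix P"
    and "stationary_distribution P \<nu>"
    and "\<And>v. \<nu> v > 0"
    and "irreducible_matrix P"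
    and "is_path_measure P \<nu> N"
    and "prob_space M"
    and "measure_preserving_action F M \<phi>"
    and "k \<ge> 1"
    and "has_good_subgraph F L P k"
  shows "equal_mod_null (N \<Otimes>\<^sub>M M) (F_tail F L N M \<phi> (2 * k)) (F_sync F L N M \<phi>)"
proof -
  interpret skew_product F L P \<nu> N M \<phi>
  proof (rule skew_product.intro)
    show "group F" using \<open>free_group F\<close> by (simp add: free_group_def)
  qed (fact assms)+
  obtain u w p q q' where len: "length p = k" "length q = k" "length q' = k"
    and paths: "directed_path P ([u] @ p @ [w])" "directed_path P ([u] @ q @ [w])"
      "directed_path P (p @ q' @ p)"
    and label: "label q' = inv\<^bsub>F\<^esub> (label q)"
    using \<open>has_good_subgraph F L P k\<close> unfolding has_good_subgraph_def by blast
  have "p \<noteq> []" "q' \<noteq> []" using len \<open>k \<ge> 1\<close> by auto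
  \<comment> \<open>The pieces overlap in nonempty paths and therefore join to one path from \<open>u\<close> to \<open>w\<close>.\<close>
  then have long: "directed_path P (u # p @ q' @ p @ [w])"
    using paths by (auto simp: directed_path_def successively_append_iff successively_Cons)
  have tail: "\<exists>B\<in>F_tail F L N M \<phi> (2 * k). sym_diff B A \<in> null_sets Q"
    if A: "A \<in> F_sync F L N M \<phi>" for A
  proof -
    obtain A' where A': "descending A'" "A' 0 = A" using F_sync_descending[OF A] by blast
    have w: "\<exists>n0. \<forall>n\<ge>n0. gap w (A' n) (A' (n + 2 * k)) \<le> e" if "e > 0" for e
      by (rule gap_good_vertex[OF A'(1) that len _ _ long label]) (use paths in simp_all)
    have "\<exists>n0. \<forall>n\<ge>n0. gap v (A' n) (A' (n + 2 * k)) \<le> e" if "e > 0" for v e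
      using \<open>irreducible_matrix P\<close>
      by (intro gap_every_vertex[OF A'(1) that _ w]) (auto simp: irreducible_matrix_def)
    then have "AE z in Q. z \<in> A \<longleftrightarrow> (T ^^ (2 * k)) z \<in> A"
      using AE_invariant[OF A'(1), of "2 * k"] A'(2) by simp
    then show ?thesis
      using F_tail_representative[OF A] \<open>k \<ge> 1\<close> by simp
  qed
  show ?thesis
    unfolding equal_mod_null_def
  proof (intro conjI ballI)
    fix A assume "A \<in> F_tail F L N M \<phi> (2 * k)"
    then show "\<exists>B\<in>F_sync F L N M \<phi>. sym_diff A B \<in> null_sets Q"
      using F_tail_subset_F_sync by (intro bexI[of _ A]) auto
  qed (use tail in blast)
qed

end
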